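(* Consider, for a zonotope $Z\subset\mathbb{R}^n$ and orthonormal vectors $u,v\in\mathbb{S}^{n-1}$, the inequality $$|Z|\,|P_{\{u,v\}^\perp}Z|_{n-2}\leq |P_{u^\perp}Z|_{n-1}\,|P_{v^\perp}Z|_{n-1}.\qquad( * )$$ 1) There exist a zonotope $Z=\sum_{i=1}^6[0,a_i]\subset\mathbb{R}^4$ with six generators and orthonormal $u,v\in\mathbb{S}^3$ for which $( * )$ fails. 2) There exist a unimodular $4\times 7$ matrix with columns $a_1,\dots,a_7$ and orthonormal $u,v\in\mathbb{S}^3$ such that $( * )$ fails for $Z=\sum_{i=1}^7[0,a_i]\subset\mathbb{R}^4$. 3) There exist a graphical and totally unimodular $5\times 7$ matrix with columns $a_1,\dots,a_7$ and orthonormal $u,v\in\mathbb{S}^4$ such that $( * )$ fails for $Z=\sum_{i=1}^7[0,a_i]\subset\mathbb{R}^5$.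
   Context: A zonotope is a finite Minkowski sum of segments. $|K|$ is $n$-dimensional Lebesgue measure in $\mathbb{R}^n$; $|K|_d$ is $d$-dimensional Hausdorff measure for a set contained in a $d$-dimensional subspace. $P_E$ is orthogonal projection onto the linear subspace $E$; $u^\perp$, $\{u,v\}^\perp$ are orthogonal complements. An integer $n\times k$ matrix of rank $n$ is unimodular if all its nonzero $n\times n$ minors have absolute value $1$. A matrix is totally unimodular if every square minor lies in $\{-1,0,1\}$. A matrix is graphical if it is the reduced signed incidence matrix of a connected graph, i.e. obtained from the vertex-edge incidence matrix of an orientation of the graph (each column has one entry $+1$ and one entry $-1$, at the two endpoints of the edge, and zeros elsewhere) by deleting the row of one vertex. *)

theory Defs
  imports "HOL-Analysis.Analysis"
begin

(* Hausdorff measure with the normalising factor (volume of the d-dimensional unit ball) / 2^d,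
   for which it agrees with Lebesgue measure on d-dimensional subspaces.  The library's diameter
   is unspecified for unbounded sets, hence the boundedness condition; empty members of a cover
   contribute 0, also when d = 0. *)
definition hausdorff_content :: "nat \<Rightarrow> real \<Rightarrow> 'a::metric_space set \<Rightarrow> ennreal" where
  "hausdorff_content d \<delta> K =
     (INF C \<in> {C :: nat \<Rightarrow> 'a set. K \<subseteq> (\<Union>i. C i) \<and> (\<forall>i. bounded (C i) \<and> diameter (C i) \<le> \<delta>)}.
        \<Sum>i. if C i = {} then 0
             else ennreal (unit_ball_vol (real d) * (diameter (C i) / 2) ^ d))"

definition hausdorff_measure :: "nat \<Rightarrow> 'a::metric_space set \<Rightarrow> ennreal" where
  "hausdorff_measure d K = (SUP \<delta> \<in> {0<..}. hausdorff_content d \<delta> K)"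

definition orth_proj :: "'a::euclidean_space set \<Rightarrow> 'a \<Rightarrow> 'a" where
  "orth_proj E x = (THE y. y \<in> E \<and> x - y \<in> E\<^sup>\<bottom>)"

(* This is a Minkowski sum of sets (Set_Algebras). *)
definition zonotope :: "('k::finite \<Rightarrow> 'a::euclidean_space) \<Rightarrow> 'a set" where
  "zonotope a = (\<Sum>i\<in>UNIV. closed_segment 0 (a i))"

definition orthonormal_pair :: "'a::real_inner \<Rightarrow> 'a \<Rightarrow> bool" where
  "orthonormal_pair u v \<longleftrightarrow> norm u = 1 \<and> norm v = 1 \<and> orthogonal u v"

definition projection_inequality :: "(real^'n) set \<Rightarrow> real^'n \<Rightarrow> real^'n \<Rightarrow> bool" where
  "projection_inequality Z u v \<longleftrightarrow>
     emeasure lebesgue Z * hausdorff_measure (CARD('n) - 2) (orth_proj ({u, v}\<^sup>\<bottom>) ` Z)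
       \<le> hausdorff_measure (CARD('n) - 1) (orth_proj ({u}\<^sup>\<bottom>) ` Z)
         * hausdorff_measure (CARD('n) - 1) (orth_proj ({v}\<^sup>\<bottom>) ` Z)"

(* The minor with row set I and column set \<sigma> ` I, where \<sigma> is injective on I.  It is det for I = UNIV;
   choosing a different bijection onto the same column set changes at most the sign. *)
definition minor :: "'n set \<Rightarrow> ('n \<Rightarrow> 'k) \<Rightarrow> real^'k^'n \<Rightarrow> real" where
  "minor I \<sigma> A = (\<Sum>p | p permutes I. of_int (sign p) * (\<Prod>i\<in>I. A $ i $ \<sigma> (p i)))"

definition integer_matrix :: "real^'k^'n \<Rightarrow> bool" where
  "integer_matrix A \<longleftrightarrow> (\<forall>i j. A $ i $ j \<in> \<int>)"

definition unimodular :: "real^'k^'n \<Rightarrow> bool" where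
  "unimodular A \<longleftrightarrow> integer_matrix A \<and> rank A = CARD('n) \<and>
     (\<forall>\<sigma>. inj \<sigma> \<longrightarrow> minor UNIV \<sigma> A \<noteq> 0 \<longrightarrow> \<bar>minor UNIV \<sigma> A\<bar> = 1)"

definition totally_unimodular :: "real^'k^'n \<Rightarrow> bool" where
  "totally_unimodular A \<longleftrightarrow> (\<forall>I \<sigma>. inj_on \<sigma> I \<longrightarrow> minor I \<sigma> A \<in> {-1, 0, 1})"

(* An orientation of a simple graph with vertex type 'v and edges indexed by 'e,
   the edge e being directed from tail e to head e. *)
definition oriented_graph :: "('e \<Rightarrow> 'v) \<Rightarrow> ('e \<Rightarrow> 'v) \<Rightarrow> bool" where
  "oriented_graph tail head \<longleftrightarrow> (\<forall>e. tail e \<noteq> head e) \<and> inj (\<lambda>e. {tail e, head e})"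

definition connected_graph :: "('e \<Rightarrow> 'v) \<Rightarrow> ('e \<Rightarrow> 'v) \<Rightarrow> bool" where
  "connected_graph tail head \<longleftrightarrow> (\<forall>x y. (x, y) \<in> {(x, y). \<exists>e. {x, y} = {tail e, head e}}\<^sup>*)"

definition incidence_matrix :: "('e \<Rightarrow> 'v) \<Rightarrow> ('e \<Rightarrow> 'v) \<Rightarrow> real^'e^'v" where
  "incidence_matrix tail head = (\<chi> x e. if x = head e then 1 else if x = tail e then -1 else 0)"

(* The vertices other than the deleted one index the rows, so the vertex type is 'n option,
   with None in the role of the deleted vertex. *)
definition graphical :: "real^'k^'n \<Rightarrow> bool" where
  "graphical A \<longleftrightarrow> (\<exists>tail head :: 'k \<Rightarrow> 'n option. oriented_graph tail head \<and> connected_graph tail head \<and>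
     A = (\<chi> i. incidence_matrix tail head $ Some i))"

end

theory Submission
  imports Defs
begin

text \<open>
  The volume of a zonotope in dimension \<open>d\<close> is the sum of the absolute values of the determinants
  of the \<open>d\<close>-tuples of its generators, because it is affine in the length of each generator and
  homogeneous of degree \<open>d\<close>. Projections of zonotopes are zonotopes, so the inequality compares
  products of such sums, which count spanning trees if the generators come from a graph.

  The counterexample in dimension 5 is the theta graph with paths of lengths 2, 2 and 3, where \<open>u\<close>
  joins the two branch vertices: the inequality would say \<open>16 * 14 \<le> 12 * 18\<close>. The one in dimension 4
  is \<open>K\<^sub>2\<^sub>,\<^sub>3\<close> with one edge of weight 2 (or doubled), again with \<open>u\<close> joining the two vertices of
  degree 3: the inequality would say \<open>20 * 16 \<le> 12 * 26\<close>.

  That Hausdorff measure is Lebesgue measure follows in one direction from Vitali's covering theorem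
  and in the other from the isodiametric inequality. The latter is the Prekopa-Leindler inequality
  for the indicators of \<open>S\<close> and \<open>-S\<close>: the set of midpoints \<open>(x - y) / 2\<close> has at least the volume of
  \<open>S\<close> and lies in the ball whose radius is half the diameter of \<open>S\<close>.
\<close>

section \<open>The Prekopa-Leindler inequality\<close>

lemma emeasure_lborel_affine_image_real:
  fixes S :: "real set"
  assumes "m \<noteq> 0" "S \<in> sets borel"
  shows "(\<lambda>x. m * x + c) ` S \<in> sets borel"
    and "emeasure lborel ((\<lambda>x. m * x + c) ` S) = ennreal \<bar>m\<bar> * emeasure lborel S"
proof -
  have eq: "(\<lambda>x. m * x + c) ` S = (\<lambda>y. (y - c) / m) -` S"
    using assms(1) by (force simp: field_simps image_iff)
  show S': "(\<lambda>x. m * x + c) ` S \<in> sets borel"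
    unfolding eq using measurable_sets_borel[of "\<lambda>y. (y - c) / m" borel S] assms(2) by simp
  have "emeasure lebesgue ((\<lambda>x. m *\<^sub>R x + c) ` S) = ennreal \<bar>m\<bar> * emeasure lebesgue S"
    using emeasure_lebesgue_affine[of m c S] by simp
  then show "emeasure lborel ((\<lambda>x. m * x + c) ` S) = ennreal \<bar>m\<bar> * emeasure lborel S"
    using S' assms(2) by (simp add: emeasure_completion)
qed

text \<open>A half-size copy of \<open>F\<close>, shifted by half a point near \<open>Inf G\<close>,
  and one of \<open>G\<close>, shifted by half a point near \<open>Sup F\<close>, both consist of
  midpoints and overlap only slightly. The set of all midpoints need not be Borel, hence the
  measurable superset \<open>H\<close>.\<close>

lemma brunn_minkowski_real:
  fixes F G H :: "real set"
  assumes [measurable]: "F \<in> sets borel" "G \<in> sets borel" "H \<in> sets borel"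
    and F: "bounded F" "F \<noteq> {}" and G: "bounded G" "G \<noteq> {}"
    and mid: "\<And>x y. x \<in> F \<Longrightarrow> y \<in> G \<Longrightarrow> (x + y) / 2 \<in> H"
  shows "emeasure lborel F + emeasure lborel G \<le> 2 * emeasure lborel H"
proof (rule ennreal_le_epsilon)
  fix e :: real assume e: "0 < e"
  have bF: "bdd_above F" and bG: "bdd_below G"
    using F G by (auto simp: bounded_imp_bdd_above bounded_imp_bdd_below)
  obtain x0 where x0: "x0 \<in> F" "Sup F - e/2 < x0"
    using less_cSupE[of "Sup F - e/2" F] F e by auto
  obtain y0 where y0: "y0 \<in> G" "y0 < Inf G + e/2"
    using cInf_lessD[of G "Inf G + e/2"] G e by auto
  \<comment> \<open>The supremum and the infimum need not be attained, so the sets are cut at points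
    within \<open>e/2\<close> of them, and each cut loses measure at most
    \<open>e/2\<close>.\<close>
  define F' where "F' = F \<inter> {..x0}"
  define G' where "G' = G \<inter> {y0<..}"
  have [measurable]: "F' \<in> sets borel" "G' \<in> sets borel"
    by (auto simp: F'_def G'_def)
  have "emeasure lborel F \<le> emeasure lborel (F' \<union> {Sup F - e/2..Sup F})"
    using x0 by (intro emeasure_mono) (auto simp: F'_def cSup_upper[OF _ bF])
  also have "\<dots> \<le> emeasure lborel F' + emeasure lborel {Sup F - e/2..Sup F}"
    by (intro emeasure_subadditive) auto
  finally have 1: "emeasure lborel F \<le> emeasure lborel F' + ennreal (e/2)"
    using e by simp
  have "emeasure lborel G \<le> emeasure lborel (G' \<union> {Inf G..Inf G + e/2})"
    using y0 by (intro emeasure_mono) (auto simp: G'_def cInf_lower[OF _ bG])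
  also have "\<dots> \<le> emeasure lborel G' + emeasure lborel {Inf G..Inf G + e/2}"
    by (intro emeasure_subadditive) auto
  finally have 2: "emeasure lborel G \<le> emeasure lborel G' + ennreal (e/2)"
    using e by simp
  \<comment> \<open>The two images are disjoint: the first lies at or below
    \<open>(x0 + y0) / 2\<close>, the second strictly above.\<close>
  let ?A = "(\<lambda>x. (1/2) * x + y0/2) ` F'" and ?B = "(\<lambda>y. (1/2) * y + x0/2) ` G'"
  have AB: "?A \<in> sets borel" "?B \<in> sets borel"
    using emeasure_lborel_affine_image_real(1)[of "1/2" F' "y0/2"]
      emeasure_lborel_affine_image_real(1)[of "1/2" G' "x0/2"] by simp_all
  have "emeasure lborel ?A + emeasure lborel ?B = emeasure lborel (?A \<union> ?B)"
    using AB by (intro plus_emeasure) (auto simp: F'_def G'_def)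
  also have "\<dots> \<le> emeasure lborel H"
  proof (intro emeasure_mono)
    show "?A \<union> ?B \<subseteq> H"
      using mid[OF _ y0(1)] mid[OF x0(1)] by (auto simp: F'_def G'_def add_divide_distrib add.commute)
  qed simp
  finally have 3: "ennreal (1/2) * emeasure lborel F' + ennreal (1/2) * emeasure lborel G' \<le> emeasure lborel H"
    using emeasure_lborel_affine_image_real(2)[of "1/2" F' "y0/2"]
      emeasure_lborel_affine_image_real(2)[of "1/2" G' "x0/2"] by simp
  have half: "2 * (ennreal (1/2) * x) = x" for x
    by (metis (no_types, opaque_lifting) ennreal_1 ennreal_numeral ennreal_mult'' field_sum_of_halves
        half_gt_zero_iff less_eq_real_def mult.assoc mult.left_neutral mult_2 zero_less_one)
  have "2 * (ennreal (1/2) * emeasure lborel F' + ennreal (1/2) * emeasure lborel G') \<le> 2 * emeasure lborel H"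
    using 3 by (rule mult_left_mono) simp
  then have 4: "emeasure lborel F' + emeasure lborel G' \<le> 2 * emeasure lborel H"
    unfolding distrib_left half .
  have "emeasure lborel F + emeasure lborel G \<le>
      (emeasure lborel F' + ennreal (e/2)) + (emeasure lborel G' + ennreal (e/2))"
    by (intro add_mono 1 2)
  also have "\<dots> = (emeasure lborel F' + emeasure lborel G') + (ennreal (e/2) + ennreal (e/2))"
    by (simp only: ac_simps)
  also have "ennreal (e/2) + ennreal (e/2) = ennreal e"
    using e by (simp flip: ennreal_plus)
  also have "emeasure lborel F' + emeasure lborel G' + ennreal e \<le> 2 * emeasure lborel H + ennreal e"
    using 4 by (intro add_mono) auto
  finally show "emeasure lborel F + emeasure lborel G \<le> 2 * emeasure lborel H + ennreal e" .
qed

section \<open>Prekopa-Leindler on the real line\<close>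

text \<open>Tonelli's theorem for the region below the graph of \<open>f\<close>, cut off at height
  1. The cut leaves only levels at which a function with supremum 1 has a nonempty superlevel
  set.\<close>

lemma nn_integral_layer_cake:
  fixes f :: "'a \<Rightarrow> ennreal"
  assumes "sigma_finite_measure M" and [measurable]: "f \<in> borel_measurable M"
  shows "(\<integral>\<^sup>+x. min 1 (f x) \<partial>M) = (\<integral>\<^sup>+t. indicator {0<..<1} t * emeasure M {x \<in> space M. ennreal t < f x} \<partial>lborel)"
proof -
  interpret sigma_finite_measure M by fact
  interpret P: pair_sigma_finite M lborel ..
  have *: "(\<integral>\<^sup>+t. indicator {0<..<1} t * indicator {t. ennreal t < c} t \<partial>lborel) = min 1 c" for c
  proof -
    obtain r where r: "0 \<le> r" "min 1 c = ennreal r"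
      by (metis ennreal_cases ennreal_one_neq_top min.cobounded1 top.extremum_unique)
    have iff: "0 < t \<and> t < 1 \<and> ennreal t < c \<longleftrightarrow> 0 < t \<and> t < r" for t
    proof (cases "0 < t")
      case True
      have "t < 1 \<and> ennreal t < c \<longleftrightarrow> ennreal t < min 1 c"
        using True by (simp add: ennreal_less_one_iff)
      also have "\<dots> \<longleftrightarrow> t < r"
        unfolding r(2) using True by (simp add: ennreal_less_iff)
      finally show ?thesis using True by simp
    qed simp
    have "(\<integral>\<^sup>+t. indicator {0<..<1} t * indicator {t. ennreal t < c} t \<partial>lborel)
        = (\<integral>\<^sup>+t. indicator {0<..<r} t \<partial>lborel)"
      using iff by (intro nn_integral_cong) (auto simp: indicator_def)
    also have "\<dots> = ennreal r" using r by simp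
    finally show ?thesis using r by simp
  qed
  have "(\<integral>\<^sup>+x. min 1 (f x) \<partial>M) = (\<integral>\<^sup>+x. (\<integral>\<^sup>+t. indicator {0<..<1} t * indicator {t. ennreal t < f x} t \<partial>lborel) \<partial>M)"
    by (simp add: *)
  also have "\<dots> = (\<integral>\<^sup>+x. (\<integral>\<^sup>+t. indicator {0<..<1} t * (if ennreal t < f x then 1 else 0) \<partial>lborel) \<partial>M)"
    by (intro nn_integral_cong) (auto simp: indicator_def)
  also have "\<dots> = (\<integral>\<^sup>+t. (\<integral>\<^sup>+x. indicator {0<..<1} t * (if ennreal t < f x then 1 else 0) \<partial>M) \<partial>lborel)"
    by (rule P.Fubini'[symmetric]) measurable
  also have "\<dots> = (\<integral>\<^sup>+t. indicator {0<..<1} t * emeasure M {x \<in> space M. ennreal t < f x} \<partial>lborel)"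
  proof (intro nn_integral_cong)
    fix t :: real
    have "(\<integral>\<^sup>+x. indicator {0<..<1} t * (if ennreal t < f x then 1 else 0) \<partial>M)
      = indicator {0<..<1} t * (\<integral>\<^sup>+x. indicator {x \<in> space M. ennreal t < f x} x \<partial>M)"
      by (subst nn_integral_cmult[symmetric]) (auto intro!: nn_integral_cong simp: indicator_def)
    then show "(\<integral>\<^sup>+x. indicator {0<..<1} t * (if ennreal t < f x then 1 else 0) \<partial>M)
      = indicator {0<..<1} t * emeasure M {x \<in> space M. ennreal t < f x}"
      by simp
  qed
  finally show ?thesis .
qed

lemma ennreal_power2_less_imp_less: "(x::ennreal)\<^sup>2 < y\<^sup>2 \<Longrightarrow> x < y"
  by (meson linorder_not_le power_mono zero_le)

text \<open>At each level \<open>t\<close> in (0, 1) the superlevel sets of \<open>f\<close> and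
  \<open>g\<close> are nonempty, as both suprema are 1, and midpoints between them lie in the
  superlevel set of \<open>h\<close>, because \<open>f x * g y\<close> exceeds the square of
  \<open>t\<close>. The bound \<open>brunn_minkowski_real\<close> is then integrated over the
  levels.\<close>

lemma prekopa_leindler_real_normalized:
  fixes f g h :: "real \<Rightarrow> ennreal"
  assumes [measurable]: "f \<in> borel_measurable borel" "g \<in> borel_measurable borel" "h \<in> borel_measurable borel"
    and supp: "bounded {x. f x \<noteq> 0}" "bounded {x. g x \<noteq> 0}"
    and Sup: "(SUP x. f x) = 1" "(SUP x. g x) = 1"
    and mid: "\<And>x y. f x * g y \<le> (h ((x + y) / 2))\<^sup>2"
  shows "(\<integral>\<^sup>+x. f x \<partial>lborel) + (\<integral>\<^sup>+x. g x \<partial>lborel) \<le> 2 * (\<integral>\<^sup>+x. h x \<partial>lborel)"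
proof -
  let ?L = "\<lambda>f t. emeasure lborel {x::real. ennreal t < f x}"
  \<comment> \<open>The measure of a superlevel set is an integral over \<open>x\<close> of a
    jointly measurable function, so it depends measurably on the level.\<close>
  have [measurable]: "(\<lambda>t. ?L F t) \<in> borel_measurable borel" if [measurable]: "F \<in> borel_measurable borel" for F
  proof -
    have "(\<lambda>t. \<integral>\<^sup>+x. (if ennreal t < F x then 1 else 0) \<partial>lborel) \<in> borel_measurable borel"
      by measurable
    moreover have "(\<integral>\<^sup>+x. (if ennreal t < F x then 1 else 0) \<partial>lborel) = ?L F t" for t
    proof -
      have "(\<integral>\<^sup>+x. (if ennreal t < F x then 1 else 0) \<partial>lborel) = (\<integral>\<^sup>+x. indicator {x. ennreal t < F x} x \<partial>lborel)"
        by (intro nn_integral_cong) (auto simp: indicator_def)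
      then show ?thesis by simp
    qed
    ultimately show ?thesis by simp
  qed
  have layer: "(\<integral>\<^sup>+x. min 1 (F x) \<partial>lborel) = (\<integral>\<^sup>+t. indicator {0<..<1} t * ?L F t \<partial>lborel)"
    if [measurable]: "F \<in> borel_measurable borel" for F
    using nn_integral_layer_cake[of lborel F] lborel.sigma_finite_measure_axioms by simp
  have le1: "f x \<le> 1" "g x \<le> 1" for x
    using Sup by (metis SUP_upper UNIV_I)+
  have level: "?L f t + ?L g t \<le> 2 * ?L h t" if t: "0 < t" "t < 1" for t
  proof (rule brunn_minkowski_real)
    have "ennreal t < 1" using t by (simp add: ennreal_less_one_iff)
    then show "{x. ennreal t < f x} \<noteq> {}" "{x. ennreal t < g x} \<noteq> {}"
      using Sup less_SUP_iff[of "ennreal t" f UNIV] less_SUP_iff[of "ennreal t" g UNIV] by auto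
    show "bounded {x. ennreal t < f x}" "bounded {x. ennreal t < g x}"
      by (auto intro: bounded_subset[OF supp(1)] bounded_subset[OF supp(2)])
    fix x y assume "x \<in> {x. ennreal t < f x}" "y \<in> {x. ennreal t < g x}"
    then have xy: "ennreal t < f x" "ennreal t < g y" by auto
    have "ennreal t * ennreal t < ennreal t * g y"
      using xy t by (intro ennreal_mult_strict_left_mono) auto
    also have "\<dots> \<le> f x * g y" using xy by (intro mult_right_mono) auto
    finally have "(ennreal t)\<^sup>2 < f x * g y"
      by (simp add: power2_eq_square)
    then have "(ennreal t)\<^sup>2 < (h ((x + y) / 2))\<^sup>2"
      using mid less_le_trans by blast
    then show "(x + y) / 2 \<in> {x. ennreal t < h x}"
      using ennreal_power2_less_imp_less by blast
  qed measurable
  have "(\<integral>\<^sup>+x. f x \<partial>lborel) + (\<integral>\<^sup>+x. g x \<partial>lborel)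
      = (\<integral>\<^sup>+x. min 1 (f x) \<partial>lborel) + (\<integral>\<^sup>+x. min 1 (g x) \<partial>lborel)"
    using le1 by (simp add: min_absorb2)
  also have "\<dots> = (\<integral>\<^sup>+t. indicator {0<..<1} t * ?L f t + indicator {0<..<1} t * ?L g t \<partial>lborel)"
    by (simp add: layer nn_integral_add)
  also have "\<dots> \<le> (\<integral>\<^sup>+t. 2 * (indicator {0<..<1} t * ?L h t) \<partial>lborel)"
    using level by (intro nn_integral_mono) (auto simp: indicator_def)
  also have "\<dots> = 2 * (\<integral>\<^sup>+x. min 1 (h x) \<partial>lborel)"
    by (simp add: layer nn_integral_cmult)
  also have "\<dots> \<le> 2 * (\<integral>\<^sup>+x. h x \<partial>lborel)"
    by (intro mult_left_mono nn_integral_mono) auto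
  finally show ?thesis .
qed

text \<open>Turns the additive bound of the normalized case into the multiplicative one.\<close>

lemma ennreal_am_gm:
  fixes a b c :: ennreal
  assumes "a + b \<le> 2 * c"
  shows "a * b \<le> c\<^sup>2"
proof (cases "c = top")
  case True
  then show ?thesis by (simp add: power2_eq_square ennreal_top_mult)
next
  case False
  then have "2 * c \<noteq> top" by (simp add: ennreal_mult_eq_top_iff)
  then have fin: "a \<noteq> top" "b \<noteq> top"
    using assms by (auto simp: top_unique)
  obtain x y z where xyz: "a = ennreal x" "0 \<le> x" "b = ennreal y" "0 \<le> y" "c = ennreal z" "0 \<le> z"
    using fin False by (metis ennreal_cases)
  have "ennreal (x + y) \<le> ennreal (2 * z)"
    using assms xyz by (simp add: ennreal_mult)
  then have "x + y \<le> 2 * z" using xyz by (subst (asm) ennreal_le_iff) auto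
  then have "(x + y)\<^sup>2 \<le> (2 * z)\<^sup>2" using xyz by (intro power_mono) auto
  moreover have "0 \<le> (x - y)\<^sup>2" by simp
  ultimately have "x * y \<le> z\<^sup>2" by (simp add: power2_eq_square algebra_simps)
  then show ?thesis using xyz by (simp add: ennreal_mult[symmetric] ennreal_power ennreal_leI)
qed

text \<open>Dividing \<open>f\<close> and \<open>g\<close> by their suprema \<open>a\<close> and
  \<open>b\<close>, and \<open>h\<close> by \<open>sqrt (a * b)\<close>, keeps the hypothesis and
  makes the suprema 1. A zero supremum makes an integral on the left vanish.\<close>

lemma prekopa_leindler_real_bounded:
  fixes f g h :: "real \<Rightarrow> ennreal"
  assumes [measurable]: "f \<in> borel_measurable borel" "g \<in> borel_measurable borel" "h \<in> borel_measurable borel"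
    and supp: "bounded {x. f x \<noteq> 0}" "bounded {x. g x \<noteq> 0}"
    and Sup: "(SUP x. f x) < top" "(SUP x. g x) < top"
    and mid: "\<And>x y. f x * g y \<le> (h ((x + y) / 2))\<^sup>2"
  shows "(\<integral>\<^sup>+x. f x \<partial>lborel) * (\<integral>\<^sup>+x. g x \<partial>lborel) \<le> (\<integral>\<^sup>+x. h x \<partial>lborel)\<^sup>2"
proof (cases "(SUP x. f x) = 0 \<or> (SUP x. g x) = 0")
  case True
  then have "(\<forall>x. f x = 0) \<or> (\<forall>x. g x = 0)"
    by (metis SUP_upper UNIV_I le_zero_eq)
  then show ?thesis by auto
next
  case False
  obtain a where a: "(SUP x. f x) = ennreal a" "a > 0"
    using Sup(1) False by (metis ennreal_cases ennreal_eq_0_iff less_irrefl linorder_not_less)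
  obtain b where b: "(SUP x. g x) = ennreal b" "b > 0"
    using Sup(2) False by (metis ennreal_cases ennreal_eq_0_iff less_irrefl linorder_not_less)
  define c where "c = sqrt (a * b)"
  have c: "c > 0" "c\<^sup>2 = a * b" using a b by (auto simp: c_def)
  let ?f = "\<lambda>x. ennreal (1/a) * f x" and ?g = "\<lambda>x. ennreal (1/b) * g x" and ?h = "\<lambda>x. ennreal (1/c) * h x"
  have "(\<integral>\<^sup>+x. ?f x \<partial>lborel) + (\<integral>\<^sup>+x. ?g x \<partial>lborel) \<le> 2 * (\<integral>\<^sup>+x. ?h x \<partial>lborel)"
  proof (rule prekopa_leindler_real_normalized)
    show "bounded {x. ?f x \<noteq> 0}" "bounded {x. ?g x \<noteq> 0}"
      by (auto intro: bounded_subset[OF supp(1)] bounded_subset[OF supp(2)])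
    show "(SUP x. ?f x) = 1" "(SUP x. ?g x) = 1"
      using a b by (simp_all add: SUP_mult_left_ennreal[symmetric] ennreal_mult[symmetric])
    fix x y
    have "ennreal (1/a * (1/b)) = ennreal (1/a) * ennreal (1/b)"
      using a b by (intro ennreal_mult) auto
    then have "?f x * ?g y = ennreal (1/a * (1/b)) * (f x * g y)"
      by (simp only: ac_simps)
    also have "\<dots> \<le> ennreal (1/a * (1/b)) * (h ((x + y) / 2))\<^sup>2"
      by (intro mult_left_mono mid) simp
    also have "1/a * (1/b) = (1/c)\<^sup>2" using c by (simp add: power_divide)
    also have "ennreal ((1/c)\<^sup>2) * (h ((x + y) / 2))\<^sup>2 = (?h ((x + y) / 2))\<^sup>2"
      using c by (simp add: power_mult_distrib ennreal_power)
    finally show "?f x * ?g y \<le> (?h ((x + y) / 2))\<^sup>2" .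
  qed measurable
  from ennreal_am_gm[OF this]
  have *: "ennreal (1/a) * (\<integral>\<^sup>+x. f x \<partial>lborel) * (ennreal (1/b) * (\<integral>\<^sup>+x. g x \<partial>lborel))
      \<le> (ennreal (1/c) * (\<integral>\<^sup>+x. h x \<partial>lborel))\<^sup>2"
    by (simp add: nn_integral_cmult)
  have "ennreal (a * b) * (ennreal (1/a) * (\<integral>\<^sup>+x. f x \<partial>lborel) * (ennreal (1/b) * (\<integral>\<^sup>+x. g x \<partial>lborel)))
      = ennreal (a * b * (1/a) * (1/b)) * ((\<integral>\<^sup>+x. f x \<partial>lborel) * (\<integral>\<^sup>+x. g x \<partial>lborel))"
    using a b by (simp add: ennreal_mult ac_simps del: times_divide_eq_right times_divide_eq_left)
  also have "a * b * (1/a) * (1/b) = 1" using a b by simp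
  finally have L: "ennreal (a * b) * (ennreal (1/a) * (\<integral>\<^sup>+x. f x \<partial>lborel) * (ennreal (1/b) * (\<integral>\<^sup>+x. g x \<partial>lborel)))
      = (\<integral>\<^sup>+x. f x \<partial>lborel) * (\<integral>\<^sup>+x. g x \<partial>lborel)" by simp
  have "ennreal (a * b) * (ennreal (1/c) * (\<integral>\<^sup>+x. h x \<partial>lborel))\<^sup>2 = ennreal (c\<^sup>2 * (1/c)\<^sup>2) * (\<integral>\<^sup>+x. h x \<partial>lborel)\<^sup>2"
  proof -
    have "ennreal (c\<^sup>2 * (1/c)\<^sup>2) = ennreal (c\<^sup>2) * ennreal ((1/c)\<^sup>2)"
      by (rule ennreal_mult) auto
    then show ?thesis
      using c by (simp add: power_mult_distrib ennreal_power mult.assoc)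
  qed
  also have "c\<^sup>2 * (1/c)\<^sup>2 = 1" using c(1) by (simp add: power_divide)
  finally have R: "ennreal (a * b) * (ennreal (1/c) * (\<integral>\<^sup>+x. h x \<partial>lborel))\<^sup>2 = (\<integral>\<^sup>+x. h x \<partial>lborel)\<^sup>2" by simp
  show ?thesis using mult_left_mono[OF *, of "ennreal (a * b)"] unfolding L R by simp
qed

text \<open>Truncation in height and support gives bounded functions below \<open>f\<close> and
  \<open>g\<close>, so the same \<open>h\<close> still serves; monotone convergence removes the
  truncation.\<close>

theorem prekopa_leindler_real:
  fixes f g h :: "real \<Rightarrow> ennreal"
  assumes [measurable]: "f \<in> borel_measurable borel" "g \<in> borel_measurable borel" "h \<in> borel_measurable borel"
    and mid: "\<And>x y. f x * g y \<le> (h ((x + y) / 2))\<^sup>2"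
  shows "(\<integral>\<^sup>+x. f x \<partial>lborel) * (\<integral>\<^sup>+x. g x \<partial>lborel) \<le> (\<integral>\<^sup>+x. h x \<partial>lborel)\<^sup>2"
proof -
  define T where "T F n x = (min (F x) (of_nat n) * indicator {-real n..real n} x :: ennreal)" for F n x
  have [measurable]: "T F n \<in> borel_measurable borel" if [measurable]: "F \<in> borel_measurable borel" for F n
    unfolding T_def by measurable
  have T_le: "T F n x \<le> F x" for F n x
    by (auto simp: T_def indicator_def)
  have T_mono: "T F m x \<le> T F n x" if "m \<le> n" for F m n x
  proof -
    have "(of_nat m :: ennreal) \<le> of_nat n" using that by (rule of_nat_mono)
    then have "min (F x) (of_nat m) \<le> min (F x) (of_nat n)" by (rule min.mono[OF order_refl])
    moreover have "indicator {-real m..real m} x \<le> (indicator {-real n..real n} x :: ennreal)"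
      using that by (auto simp: indicator_def)
    ultimately show ?thesis unfolding T_def by (intro mult_mono) auto
  qed
  have T_SUP: "(SUP n. T F n x) = F x" for F x
  proof (rule antisym)
    show "(SUP n. T F n x) \<le> F x" by (intro SUP_least T_le)
    show "F x \<le> (SUP n. T F n x)"
    proof (rule le_SUP_iff[THEN iffD2], intro allI impI)
      fix y assume y: "y < F x"
      then obtain k where k: "y < of_nat k" using ennreal_Ex_less_of_nat by (metis top.not_eq_extremum not_less_iff_gr_or_eq order_less_trans top_greatest linorder_not_less)
      obtain l :: nat where l: "\<bar>x\<bar> \<le> real l" using real_arch_simple by blast
      let ?n = "max k l"
      have "y < T F ?n x"
      proof -
        have "(of_nat k :: ennreal) \<le> of_nat ?n" by (rule of_nat_mono) simp
        then have "y < min (F x) (of_nat ?n)" using y order.strict_trans2[OF k] by (simp del: of_nat_max)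
        then show ?thesis using l by (auto simp: T_def indicator_def)
      qed
      then show "\<exists>i\<in>UNIV. y < T F i x" by blast
    qed
  qed
  have T_int: "(\<integral>\<^sup>+x. F x \<partial>lborel) = (SUP n. \<integral>\<^sup>+x. T F n x \<partial>lborel)"
    if [measurable]: "F \<in> borel_measurable borel" for F
    by (subst nn_integral_monotone_convergence_SUP[symmetric])
      (auto simp: T_SUP incseq_def le_fun_def intro: T_mono)
  have T_supp: "bounded {x. T F n x \<noteq> 0}" for F n
    by (rule bounded_subset[of "{-real n..real n}"]) (auto simp: T_def indicator_def)
  have T_fin: "(SUP x. T F n x) < top" for F n
  proof -
    have "(SUP x. T F n x) \<le> of_nat n" by (intro SUP_least) (auto simp: T_def indicator_def)
    also have "(of_nat n :: ennreal) < top" by (rule of_nat_less_top)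
    finally show ?thesis .
  qed
  \<comment> \<open>Independent indices \<open>n\<close> and \<open>m\<close> let the two suprema be
    taken one after the other.\<close>
  have bnd: "(\<integral>\<^sup>+x. T f n x \<partial>lborel) * (\<integral>\<^sup>+x. T g m x \<partial>lborel) \<le> (\<integral>\<^sup>+x. h x \<partial>lborel)\<^sup>2" for n m
    by (intro prekopa_leindler_real_bounded T_supp T_fin order.trans[OF mult_mono[OF T_le T_le] mid]) measurable
  show ?thesis
    unfolding T_int[OF assms(1)] T_int[OF assms(2)]
    by (simp add: SUP_mult_left_ennreal SUP_mult_right_ennreal SUP_least bnd)
qed

section \<open>Prekopa-Leindler in higher dimensions\<close>

text \<open>Induction on the coordinates: the induction hypothesis for the slices at
  \<open>s\<close>, \<open>t\<close> and \<open>(s + t) / 2\<close> is the one-dimensional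
  hypothesis for the integrals over slices. Points of the product are extensional functions, so the
  midpoint is restricted to \<open>I\<close>.\<close>

theorem prekopa_leindler_PiM:
  fixes f g h :: "('i \<Rightarrow> real) \<Rightarrow> ennreal"
  assumes "finite I"
    and "f \<in> borel_measurable (Pi\<^sub>M I (\<lambda>_. lborel))"
    and "g \<in> borel_measurable (Pi\<^sub>M I (\<lambda>_. lborel))"
    and "h \<in> borel_measurable (Pi\<^sub>M I (\<lambda>_. lborel))"
    and "\<And>x y. x \<in> extensional I \<Longrightarrow> y \<in> extensional I \<Longrightarrow> f x * g y \<le> (h (\<lambda>i\<in>I. (x i + y i) / 2))\<^sup>2"
  shows "(\<integral>\<^sup>+x. f x \<partial>Pi\<^sub>M I (\<lambda>_. lborel)) * (\<integral>\<^sup>+x. g x \<partial>Pi\<^sub>M I (\<lambda>_. lborel))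
      \<le> (\<integral>\<^sup>+x. h x \<partial>Pi\<^sub>M I (\<lambda>_. lborel))\<^sup>2"
  using assms
proof (induction I arbitrary: f g h rule: finite_induct)
  case empty
  have "f (\<lambda>_. undefined) * g (\<lambda>_. undefined) \<le> (h (\<lambda>_. undefined))\<^sup>2"
    using empty(4)[of "\<lambda>_. undefined" "\<lambda>_. undefined"] by (simp add: restrict_def)
  then show ?case by (simp add: nn_integral_count_space_finite PiM_empty)
next
  case (insert i I)
  interpret product_sigma_finite "\<lambda>_. lborel :: real measure"
    by standard
  interpret P: sigma_finite_measure "Pi\<^sub>M I (\<lambda>_. lborel :: real measure)"
    by (rule sigma_finite) fact
  note [measurable] = insert.prems(1-3)
  let ?P = "Pi\<^sub>M I (\<lambda>_. lborel :: real measure)"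
  have upd: "(\<lambda>x. F (x(i := s))) \<in> borel_measurable ?P"
    if [measurable]: "F \<in> borel_measurable (Pi\<^sub>M (insert i I) (\<lambda>_. lborel))" for F :: "_ \<Rightarrow> ennreal" and s
    by (rule measurable_compose[OF _ that], rule measurable_fun_upd[where J=I]) auto
  have upd2: "(\<lambda>s. \<integral>\<^sup>+x. F (x(i := s)) \<partial>?P) \<in> borel_measurable borel"
    if [measurable]: "F \<in> borel_measurable (Pi\<^sub>M (insert i I) (\<lambda>_. lborel))" for F :: "_ \<Rightarrow> ennreal"
  proof -
    have "(\<lambda>(x, s). F (x(i := s))) \<in> borel_measurable (?P \<Otimes>\<^sub>M lborel)"
      using measurable_compose[OF measurable_add_dim that] by (simp add: case_prod_beta')
    then have "(\<lambda>(s, x). F (x(i := s))) \<in> borel_measurable (lborel \<Otimes>\<^sub>M ?P)"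
      by (subst measurable_pair_swap_iff) (simp add: case_prod_beta')
    then show ?thesis
      using P.borel_measurable_nn_integral[of "\<lambda>s x. F (x(i := s))" lborel] by simp
  qed
  have "(\<integral>\<^sup>+s. \<integral>\<^sup>+x. f (x(i := s)) \<partial>?P \<partial>lborel) * (\<integral>\<^sup>+s. \<integral>\<^sup>+x. g (x(i := s)) \<partial>?P \<partial>lborel)
      \<le> (\<integral>\<^sup>+s. \<integral>\<^sup>+x. h (x(i := s)) \<partial>?P \<partial>lborel)\<^sup>2"
  proof (rule prekopa_leindler_real)
    fix s t :: real
    show "(\<integral>\<^sup>+x. f (x(i := s)) \<partial>?P) * (\<integral>\<^sup>+x. g (x(i := t)) \<partial>?P) \<le> (\<integral>\<^sup>+x. h (x(i := (s + t) / 2)) \<partial>?P)\<^sup>2"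
    proof (rule insert.IH)
      fix x y :: "'i \<Rightarrow> real" assume xy: "x \<in> extensional I" "y \<in> extensional I"
      have "f (x(i := s)) * g (y(i := t)) \<le> (h (\<lambda>j\<in>insert i I. ((x(i := s)) j + (y(i := t)) j) / 2))\<^sup>2"
        using xy by (intro insert.prems) (auto simp: extensional_def)
      also have "(\<lambda>j\<in>insert i I. ((x(i := s)) j + (y(i := t)) j) / 2) = (\<lambda>j\<in>I. (x j + y j) / 2)(i := (s + t) / 2)"
        using insert.hyps by (auto simp: fun_eq_iff)
      finally show "f (x(i := s)) * g (y(i := t)) \<le> (h ((\<lambda>j\<in>I. (x j + y j) / 2)(i := (s + t) / 2)))\<^sup>2" .
    qed (intro upd insert.prems)+
  qed (intro upd2 insert.prems)+
  then show ?case
    using insert.hyps by (simp add: product_nn_integral_insert_rev)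
qed

text \<open>Transfers the product version along the coordinate map \<open>?e\<close>, under which
  \<open>lborel\<close> is the image of the product measure.\<close>

theorem prekopa_leindler:
  fixes f g h :: "'a::euclidean_space \<Rightarrow> ennreal"
  assumes [measurable]: "f \<in> borel_measurable borel" "g \<in> borel_measurable borel" "h \<in> borel_measurable borel"
    and mid: "\<And>x y. f x * g y \<le> (h ((1/2) *\<^sub>R (x + y)))\<^sup>2"
  shows "(\<integral>\<^sup>+x. f x \<partial>lborel) * (\<integral>\<^sup>+x. g x \<partial>lborel) \<le> (\<integral>\<^sup>+x. h x \<partial>lborel)\<^sup>2"
proof -
  let ?P = "Pi\<^sub>M Basis (\<lambda>_. lborel) :: ('a \<Rightarrow> real) measure" and ?e = "\<lambda>x. \<Sum>b\<in>Basis. x b *\<^sub>R (b::'a)"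
  have [measurable]: "?e \<in> borel_measurable ?P" by measurable
  have int: "(\<integral>\<^sup>+x. F x \<partial>lborel) = (\<integral>\<^sup>+x. F (?e x) \<partial>?P)"
    if [measurable]: "F \<in> borel_measurable borel" for F :: "'a \<Rightarrow> ennreal"
    by (subst lborel_eq, subst nn_integral_distr) auto
  have "(\<integral>\<^sup>+x. f (?e x) \<partial>?P) * (\<integral>\<^sup>+x. g (?e x) \<partial>?P) \<le> (\<integral>\<^sup>+x. h (?e x) \<partial>?P)\<^sup>2"
  proof (rule prekopa_leindler_PiM)
    fix x y :: "'a \<Rightarrow> real"
    have "?e (\<lambda>b\<in>Basis. (x b + y b) / 2) = (1/2) *\<^sub>R (?e x + ?e y)"
      by (simp add: scaleR_sum_right sum.distrib[symmetric] scaleR_add_left[symmetric] add_divide_distrib cong: sum.cong)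
    then show "f (?e x) * g (?e y) \<le> (h (?e (\<lambda>b\<in>Basis. (x b + y b) / 2)))\<^sup>2"
      using mid[of "?e x" "?e y"] by simp
  qed auto
  then show ?thesis by (simp add: int)
qed

section \<open>The isodiametric inequality\<close>

lemma ennreal_power2_strict_mono:
  fixes x y :: ennreal
  assumes "x < y"
  shows "x\<^sup>2 < y\<^sup>2"
proof (cases "x = 0")
  case True
  then show ?thesis using assms by (simp add: power2_eq_square ennreal_zero_less_mult_iff)
next
  case False
  then have "x * x < x * y"
    using assms by (intro ennreal_mult_strict_left_mono) (auto simp: zero_less_iff_neq_zero order.strict_trans2)
  also have "\<dots> \<le> y * y" using assms by (intro mult_right_mono) auto
  finally show ?thesis by (simp add: power2_eq_square)
qed

text \<open>For compact \<open>S\<close> the reflected set and the set \<open>D\<close> of half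
  differences are compact, hence Borel. As \<open>S\<close> and its reflection have the same volume,
  the product inequality becomes a comparison of squares.\<close>

theorem isodiametric_inequality:
  fixes S :: "'a::euclidean_space set"
  assumes "compact S"
  shows "emeasure lborel S \<le> ennreal (unit_ball_vol (real DIM('a)) * (diameter S / 2) ^ DIM('a))"
proof -
  define D where "D = (\<lambda>(x, y). (1/2) *\<^sub>R (x - y)) ` (S \<times> S)"
  have neg: "compact (uminus ` S)"
    by (intro compact_continuous_image continuous_intros assms)
  have D: "compact D"
    unfolding D_def case_prod_beta by (intro compact_continuous_image compact_Times assms continuous_intros)
  have "(\<integral>\<^sup>+x. indicator S x \<partial>lborel) * (\<integral>\<^sup>+x. indicator (uminus ` S) x \<partial>lborel) \<le> (\<integral>\<^sup>+x. indicator D x \<partial>lborel)\<^sup>2"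
  proof (rule prekopa_leindler)
    fix x y :: 'a
    show "indicator S x * indicator (uminus ` S) y \<le> (indicator D ((1/2) *\<^sub>R (x + y)) :: ennreal)\<^sup>2"
      by (force simp: indicator_def D_def)
  qed (use assms neg D in \<open>auto intro!: borel_measurable_indicator borel_compact\<close>)
  then have "emeasure lborel S * emeasure lborel (uminus ` S) \<le> (emeasure lborel D)\<^sup>2"
    using assms neg D by (simp add: borel_compact)
  moreover have "emeasure lborel (uminus ` S) = emeasure lborel S"
    using emeasure_lebesgue_affine[of "-1" 0 S] assms neg by (simp add: emeasure_completion borel_compact)
  ultimately have "emeasure lborel S \<le> emeasure lborel D"
    using ennreal_power2_strict_mono by (metis linorder_not_less power2_eq_square)
  also have "\<dots> \<le> emeasure lborel (cball 0 (diameter S / 2) :: 'a set)"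
  proof (intro emeasure_mono)
    show "D \<subseteq> cball 0 (diameter S / 2)"
      using diameter_bounded_bound[OF compact_imp_bounded[OF assms]] by (auto simp: D_def dist_norm)
  qed simp
  also have "\<dots> = ennreal (unit_ball_vol (real DIM('a)) * (diameter S / 2) ^ DIM('a))"
    using diameter_ge_0[OF compact_imp_bounded[OF assms]] by (intro emeasure_cball) simp
  finally show ?thesis .
qed

section \<open>Hausdorff measure and Lebesgue measure\<close>

text \<open>The images of the members of a cover form a cover whose terms are no larger. The members
  are first intersected with \<open>K\<close>, since \<open>g\<close> is known to preserve distances
  only there.\<close>

lemma hausdorff_content_isometry_le:
  fixes g :: "'a::metric_space \<Rightarrow> 'b::metric_space"
  assumes iso: "\<And>x y. x \<in> K \<Longrightarrow> y \<in> K \<Longrightarrow> dist (g x) (g y) = dist x y"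
  shows "hausdorff_content d \<delta> (g ` K) \<le> hausdorff_content d \<delta> K"
  unfolding hausdorff_content_def
proof (rule INF_greatest)
  fix C :: "nat \<Rightarrow> 'a set"
  assume "C \<in> {C. K \<subseteq> (\<Union>i. C i) \<and> (\<forall>i. bounded (C i) \<and> diameter (C i) \<le> \<delta>)}"
  then have C: "K \<subseteq> (\<Union>i. C i)" "\<And>i. bounded (C i)" "\<And>i. diameter (C i) \<le> \<delta>" by auto
  let ?D = "\<lambda>i. g ` (C i \<inter> K)"
  have bd: "dist x y \<le> diameter (C i)" if "x \<in> ?D i" "y \<in> ?D i" for x y i
    using that iso diameter_bounded_bound[OF C(2)[of i]] by auto
  have bounded: "bounded (?D i)" for i
    unfolding bounded_two_points using bd by blast
  have diam: "diameter (?D i) \<le> diameter (C i)" for i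
  proof (cases "?D i = {}")
    case True
    then show ?thesis using diameter_ge_0[OF C(2)] by simp
  next
    case False
    then have "diameter (?D i) = (SUP z \<in> ?D i \<times> ?D i. dist (fst z) (snd z))"
      unfolding diameter_def by (simp add: case_prod_beta')
    also have "\<dots> \<le> diameter (C i)"
    proof (rule cSUP_least)
      show "?D i \<times> ?D i \<noteq> {}" using False by simp
      show "dist (fst z) (snd z) \<le> diameter (C i)" if "z \<in> ?D i \<times> ?D i" for z
        using that by (intro bd) (auto simp: mem_Times_iff)
    qed
    finally show ?thesis .
  qed
  show "(INF C\<in>{C. g ` K \<subseteq> (\<Union>i. C i) \<and> (\<forall>i. bounded (C i) \<and> diameter (C i) \<le> \<delta>)}.
      \<Sum>i. if C i = {} then 0 else ennreal (unit_ball_vol (real d) * (diameter (C i) / 2) ^ d))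
    \<le> (\<Sum>i. if C i = {} then 0 else ennreal (unit_ball_vol (real d) * (diameter (C i) / 2) ^ d))"
  proof (rule INF_lower2[where i = ?D])
    show "?D \<in> {C. g ` K \<subseteq> (\<Union>i. C i) \<and> (\<forall>i. bounded (C i) \<and> diameter (C i) \<le> \<delta>)}"
    proof (intro CollectI conjI allI)
      show "g ` K \<subseteq> (\<Union>i. ?D i)"
      proof (rule image_subsetI)
        fix x assume x: "x \<in> K"
        then obtain i where "x \<in> C i" using C(1) by blast
        then show "g x \<in> (\<Union>i. ?D i)" using x by blast
      qed
    qed (rule bounded order.trans[OF diam C(3)])+
    show "(\<Sum>i. if ?D i = {} then 0 else ennreal (unit_ball_vol (real d) * (diameter (?D i) / 2) ^ d))
      \<le> (\<Sum>i. if C i = {} then 0 else ennreal (unit_ball_vol (real d) * (diameter (C i) / 2) ^ d))"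
    proof (intro suminf_le allI)
      fix i
      show "(if ?D i = {} then 0 else ennreal (unit_ball_vol (real d) * (diameter (?D i) / 2) ^ d))
          \<le> (if C i = {} then 0 else ennreal (unit_ball_vol (real d) * (diameter (C i) / 2) ^ d))"
        using diam[of i] diameter_ge_0[OF bounded[of i]]
        by (auto intro!: ennreal_leI mult_left_mono power_mono)
    qed auto
  qed
qed

text \<open>The inverse of \<open>g\<close> on the image is again an isometry, so the inequality of
  contents holds both ways.\<close>

lemma hausdorff_measure_isometry:
  fixes g :: "'a::metric_space \<Rightarrow> 'b::metric_space"
  assumes iso: "\<And>x y. x \<in> K \<Longrightarrow> y \<in> K \<Longrightarrow> dist (g x) (g y) = dist x y"
  shows "hausdorff_measure d (g ` K) = hausdorff_measure d K"
proof -
  have inj: "inj_on g K"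
    using iso by (intro inj_onI) (metis dist_eq_0_iff)
  have "hausdorff_content d \<delta> (g ` K) = hausdorff_content d \<delta> K" for \<delta>
  proof (rule antisym)
    show "hausdorff_content d \<delta> (g ` K) \<le> hausdorff_content d \<delta> K"
      using iso by (rule hausdorff_content_isometry_le)
    have "hausdorff_content d \<delta> (inv_into K g ` g ` K) \<le> hausdorff_content d \<delta> (g ` K)"
      using inj by (intro hausdorff_content_isometry_le) (auto simp: iso)
    then show "hausdorff_content d \<delta> K \<le> hausdorff_content d \<delta> (g ` K)"
      using inj by (simp add: inv_into_image_cancel)
  qed
  then show ?thesis by (simp add: hausdorff_measure_def)
qed

section \<open>Comparison with Lebesgue measure\<close>

text \<open>By the isodiametric inequality, each member of a cover contributes at least the volume
  of its closure. The scale 1 is arbitrary: the content at any positive scale is at most the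
  measure.\<close>

lemma emeasure_le_hausdorff_measure:
  fixes K :: "'a::euclidean_space set"
  shows "emeasure lborel K \<le> hausdorff_measure DIM('a) K"
proof -
  have "emeasure lborel K \<le> hausdorff_content DIM('a) 1 K"
    unfolding hausdorff_content_def
  proof (rule INF_greatest)
    fix C :: "nat \<Rightarrow> 'a set"
    assume "C \<in> {C. K \<subseteq> (\<Union>i. C i) \<and> (\<forall>i. bounded (C i) \<and> diameter (C i) \<le> 1)}"
    then have C: "K \<subseteq> (\<Union>i. C i)" "\<And>i. bounded (C i)" by auto
    have "emeasure lborel K \<le> emeasure lborel (\<Union>i. closure (C i))"
      using C(1) closure_subset by (intro emeasure_mono) (blast, auto)
    also have "\<dots> \<le> (\<Sum>i. emeasure lborel (closure (C i)))"
      by (intro emeasure_subadditive_countably) auto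
    also have "\<dots> \<le> (\<Sum>i. if C i = {} then 0
        else ennreal (unit_ball_vol (real DIM('a)) * (diameter (C i) / 2) ^ DIM('a)))"
    proof (intro suminf_le allI)
      fix i
      show "emeasure lborel (closure (C i)) \<le> (if C i = {} then 0
        else ennreal (unit_ball_vol (real DIM('a)) * (diameter (C i) / 2) ^ DIM('a)))"
        using isodiametric_inequality[of "closure (C i)"] C(2)[of i] by (auto simp: diameter_closure)
    qed auto
    finally show "emeasure lborel K \<le> (\<Sum>i. if C i = {} then 0
        else ennreal (unit_ball_vol (real DIM('a)) * (diameter (C i) / 2) ^ DIM('a)))" .
  qed
  also have "\<dots> \<le> hausdorff_measure DIM('a) K"
    unfolding hausdorff_measure_def by (intro SUP_upper) simp
  finally show ?thesis .
qed

text \<open>For a ball the summand of the content is its volume. Balls are encoded as pairs of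
  centre and radius, and integrals over \<open>count_space I\<close> serve as sums over a countable
  index set. The sequence that the content asks for is filled up with empty sets, which contribute
  0.\<close>

lemma hausdorff_content_le_balls:
  fixes K :: "'a::euclidean_space set"
  assumes I: "countable I" "\<And>p. p \<in> I \<Longrightarrow> snd p \<le> \<delta> / 2" and "0 \<le> \<delta>"
    and K: "K \<subseteq> (\<Union>p\<in>I. ball (fst p) (snd p))"
  shows "hausdorff_content DIM('a) \<delta> K \<le> (\<integral>\<^sup>+p. emeasure lborel (ball (fst p) (snd p)) \<partial>count_space I)"
proof -
  let ?t = "\<lambda>C. if C = {} then 0 else ennreal (unit_ball_vol (real DIM('a)) * (diameter C / 2) ^ DIM('a))"
  have t: "?t (ball x r) = emeasure lborel (ball x r)" for x :: 'a and r
  proof (cases "r > 0")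
    case True
    then show ?thesis by (simp add: emeasure_ball)
  next
    case False
    then have "ball x r = {}" by simp
    then show ?thesis by (simp only: simp_thms if_True emeasure_empty)
  qed
  let ?J = "to_nat_on I ` I"
  define C where "C n = (if n \<in> ?J then (\<lambda>p. ball (fst p) (snd p)) (from_nat_into I n) else {})" for n
  have bij: "bij_betw (to_nat_on I) I ?J"
    using I(1) by (intro inj_on_imp_bij_betw inj_on_to_nat_on)
  have C: "C (to_nat_on I p) = ball (fst p) (snd p)" if "p \<in> I" for p
    using that I(1) by (simp add: C_def)
  have "hausdorff_content DIM('a) \<delta> K \<le> (\<Sum>i. ?t (C i))"
    unfolding hausdorff_content_def
  proof (rule INF_lower, safe)
    show "x \<in> (\<Union>i. C i)" if x: "x \<in> K" for x
    proof -
      obtain p where "p \<in> I" "x \<in> ball (fst p) (snd p)" using x K by blast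
      then have "x \<in> C (to_nat_on I p)" by (simp only: C)
      then show ?thesis by blast
    qed
    show "bounded (C i)" for i by (simp add: C_def)
    show "diameter (C i) \<le> \<delta>" for i
    proof (cases "i \<in> ?J")
      case True
      then obtain p where p: "p \<in> I" "i = to_nat_on I p" by auto
      have "diameter (ball (fst p) (snd p)) \<le> \<delta>"
        using I(2)[OF p(1)] \<open>0 \<le> \<delta>\<close> by (simp only: diameter_ball) simp
      then show ?thesis by (simp only: p(2) C[OF p(1)])
    next
      case False
      then have "C i = {}" by (simp only: C_def if_False)
      then show ?thesis using \<open>0 \<le> \<delta>\<close> by (simp only: diameter_empty)
    qed
  qed
  also have "\<dots> = (\<integral>\<^sup>+n. ?t (C n) \<partial>count_space UNIV)"
    by (simp add: nn_integral_count_space_nat)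
  also have "\<dots> = (\<integral>\<^sup>+n. ?t (C n) \<partial>count_space ?J)"
    by (intro nn_integral_count_space_eq) (auto simp: C_def)
  also have "\<dots> = (\<integral>\<^sup>+p. ?t (C (to_nat_on I p)) \<partial>count_space I)"
    using nn_integral_bij_count_space[OF bij, of "\<lambda>n. ?t (C n)"] by simp
  also have "\<dots> = (\<integral>\<^sup>+p. emeasure lborel (ball (fst p) (snd p)) \<partial>count_space I)"
    by (intro nn_integral_cong) (simp only: C space_count_space t)
  finally show ?thesis .
qed

lemma nn_integral_count_space_Un_le:
  "(\<integral>\<^sup>+x. f x \<partial>count_space (A \<union> B)) \<le> (\<integral>\<^sup>+x. f x \<partial>count_space A) + (\<integral>\<^sup>+x. f x \<partial>count_space B)"
proof -
  have "(\<integral>\<^sup>+x. f x \<partial>count_space (A \<union> B)) = (\<integral>\<^sup>+x. f x * indicator (A \<union> B) x \<partial>count_space UNIV)"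
    by (simp add: nn_integral_count_space_indicator)
  also have "\<dots> \<le> (\<integral>\<^sup>+x. f x * indicator A x + f x * indicator B x \<partial>count_space UNIV)"
    by (intro nn_integral_mono) (auto simp: indicator_def)
  also have "\<dots> = (\<integral>\<^sup>+x. f x \<partial>count_space A) + (\<integral>\<^sup>+x. f x \<partial>count_space B)"
    by (simp add: nn_integral_add nn_integral_count_space_indicator)
  finally show ?thesis .
qed

lemma emeasure_disjoint_balls_le:
  fixes U :: "'a::euclidean_space set"
  assumes "countable I" "pairwise (\<lambda>i j. disjnt (ball (fst i) (snd i)) (ball (fst j) (snd j))) I"
    and "\<And>p. p \<in> I \<Longrightarrow> ball (fst p) (snd p) \<subseteq> U" and "open U"
  shows "(\<integral>\<^sup>+p. emeasure lborel (ball (fst p) (snd p)) \<partial>count_space I) \<le> emeasure lborel U"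
proof -
  have "(\<integral>\<^sup>+p. emeasure lborel (ball (fst p) (snd p)) \<partial>count_space I)
      = emeasure lborel (\<Union>p\<in>I. ball (fst p) (snd p))"
    using assms(1,2)
    by (intro emeasure_UN_countable[symmetric]) (auto simp: disjoint_family_on_def pairwise_def disjnt_def)
  also have "\<dots> \<le> emeasure lborel U"
    using assms(3,4) by (intro emeasure_mono) auto
  finally show ?thesis .
qed

lemma open_superset_emeasure_le:
  fixes S :: "'a::euclidean_space set"
  assumes "S \<in> sets lebesgue" and "e > 0"
  obtains U where "open U" "S \<subseteq> U" "emeasure lborel U \<le> emeasure lebesgue S + ennreal e"
proof -
  obtain U where U: "open U" "S \<subseteq> U" "U - S \<in> lmeasurable" "emeasure lebesgue (U - S) < ennreal e"
    using sets_lebesgue_outer_open[OF assms] by metis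
  have "emeasure lborel U = emeasure lebesgue (S \<union> (U - S))"
    using U by (simp add: emeasure_completion Un_absorb1)
  also have "\<dots> \<le> emeasure lebesgue S + emeasure lebesgue (U - S)"
    using assms U by (intro emeasure_subadditive) auto
  also have "\<dots> \<le> emeasure lebesgue S + ennreal e"
    using U by (intro add_left_mono) auto
  finally show thesis using that U by blast
qed

text \<open>Vitali's covering lemma inside an open set of tiny volume: the disjoint balls it selects
  have total volume at most that of \<open>U\<close>, and their fivefold enlargements cover
  \<open>N\<close>.\<close>

lemma negligible_ball_cover:
  fixes N :: "'a::euclidean_space set"
  assumes N: "negligible N" and e: "e > 0" and \<delta>: "\<delta> > 0"
  obtains I where "countable I" "\<And>p. p \<in> I \<Longrightarrow> snd p \<le> \<delta> / 2"
    "N \<subseteq> (\<Union>p\<in>I. ball (fst p) (snd p))"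
    "(\<integral>\<^sup>+p. emeasure lborel (ball (fst p) (snd p)) \<partial>count_space I) \<le> ennreal e"
proof -
  have N0: "N \<in> sets lebesgue" "emeasure lebesgue N = 0"
    using N by (auto simp: negligible_iff_null_sets null_sets_def)
  \<comment> \<open>The denominator compensates for the growth of volume when the radii are
    multiplied by 5.\<close>
  have pos: "0 < e / 5 ^ DIM('a)" using e by simp
  obtain U where U: "open U" "N \<subseteq> U"
      and "emeasure lborel U \<le> emeasure lebesgue N + ennreal (e / 5 ^ DIM('a))"
    by (rule open_superset_emeasure_le[OF N0(1) pos])
  then have U_le: "emeasure lborel U \<le> ennreal (e / 5 ^ DIM('a))"
    by (simp only: N0(2) add_0)
  \<comment> \<open>Radii up to \<open>\<delta> / 10\<close> become at most
    \<open>\<delta> / 2\<close> after the enlargement.\<close>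
  have "\<exists>r>0. r \<le> \<delta> / 10 \<and> ball x r \<subseteq> U" if x: "x \<in> N" for x
  proof -
    obtain r where r: "r > 0" "ball x r \<subseteq> U" using openE[OF U(1)] U(2) x by blast
    have "ball x (min r (\<delta> / 10)) \<subseteq> ball x r" by (rule subset_ball) simp
    then show ?thesis using r \<delta> by (intro exI[of _ "min r (\<delta> / 10)"] conjI) (simp_all add: order.trans)
  qed
  then obtain \<rho> where \<rho>: "\<And>x. x \<in> N \<Longrightarrow> \<rho> x > 0 \<and> \<rho> x \<le> \<delta> / 10 \<and> ball x (\<rho> x) \<subseteq> U"
    by metis
  obtain C where C: "countable C" "C \<subseteq> N"
      "pairwise (\<lambda>i j. disjnt (ball i (\<rho> i)) (ball j (\<rho> j))) C"
      "N \<subseteq> (\<Union>i\<in>C. ball i (5 * \<rho> i))"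
  proof (rule Vitali_covering_lemma_balls[of N "\<lambda>x. x" \<rho> N "\<delta> / 10"])
    show "N \<subseteq> (\<Union>i\<in>N. ball i (\<rho> i))" using \<rho> by force
  qed (use \<rho> in auto)
  let ?I = "(\<lambda>x. (x, 5 * \<rho> x)) ` C" and ?I' = "(\<lambda>x. (x, \<rho> x)) ` C"
  have bij: "bij_betw (\<lambda>x. (x, k * \<rho> x)) C ((\<lambda>x. (x, k * \<rho> x)) ` C)" for k
    by (intro inj_on_imp_bij_betw) (auto simp: inj_on_def)
  show thesis
  proof (rule that[of ?I])
    have "(\<integral>\<^sup>+p. emeasure lborel (ball (fst p) (snd p)) \<partial>count_space ?I)
        = (\<integral>\<^sup>+x. emeasure lborel (ball x (5 * \<rho> x)) \<partial>count_space C)"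
      by (subst nn_integral_bij_count_space[OF bij, symmetric]) simp
    also have "\<dots> = (\<integral>\<^sup>+x. 5 ^ DIM('a) * emeasure lborel (ball x (\<rho> x)) \<partial>count_space C)"
    proof (intro nn_integral_cong)
      fix x assume "x \<in> space (count_space C)"
      then have "\<rho> x > 0" using C \<rho> by auto
      then show "emeasure lborel (ball x (5 * \<rho> x)) = 5 ^ DIM('a) * emeasure lborel (ball x (\<rho> x))"
        by (simp add: emeasure_ball power_mult_distrib ennreal_mult' flip: ennreal_power)
          (simp add: ac_simps ennreal_mult ennreal_power)
    qed
    also have "\<dots> = 5 ^ DIM('a) * (\<integral>\<^sup>+x. emeasure lborel (ball x (\<rho> x)) \<partial>count_space C)"
      by (simp add: nn_integral_cmult)
    also have "(\<integral>\<^sup>+x. emeasure lborel (ball x (\<rho> x)) \<partial>count_space C)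
        = (\<integral>\<^sup>+p. emeasure lborel (ball (fst p) (snd p)) \<partial>count_space ?I')"
      using bij[of 1] by (subst nn_integral_bij_count_space[of "\<lambda>x. (x, \<rho> x)" C, symmetric]) simp_all
    also have "\<dots> \<le> emeasure lborel U"
    proof (rule emeasure_disjoint_balls_le)
      show "pairwise (\<lambda>i j. disjnt (ball (fst i) (snd i)) (ball (fst j) (snd j))) ?I'"
        using C(3) by (auto simp: pairwise_def)
      show "ball (fst p) (snd p) \<subseteq> U" if "p \<in> ?I'" for p
        using that C(2) \<rho> by (metis (no_types, lifting) fst_conv imageE snd_conv subsetD)
    qed (use C(1) U(1) in auto)
    also have "\<dots> \<le> ennreal (e / 5 ^ DIM('a))" by (rule U_le)
    also have "5 ^ DIM('a) * ennreal (e / 5 ^ DIM('a)) = ennreal (5 ^ DIM('a) * (e / 5 ^ DIM('a)))"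
      using e by (subst ennreal_mult) (auto simp flip: ennreal_power)
    finally show "(\<integral>\<^sup>+p. emeasure lborel (ball (fst p) (snd p)) \<partial>count_space ?I) \<le> ennreal e"
      by (simp add: mult_left_mono)
    show "N \<subseteq> (\<Union>p\<in>?I. ball (fst p) (snd p))" using C(4) by auto
    show "snd p \<le> \<delta> / 2" if "p \<in> ?I" for p
      using that \<rho> C(2) by fastforce
  qed (use C(1) in auto)
qed

text \<open>By Vitali's theorem, disjoint small balls inside an open set slightly larger than
  \<open>K\<close> exhaust \<open>K\<close> up to a negligible set; balls of total volume at most
  \<open>e/2\<close> cover the rest.\<close>

lemma hausdorff_measure_le_emeasure:
  fixes K :: "'a::euclidean_space set"
  assumes K: "compact K"
  shows "hausdorff_measure DIM('a) K \<le> emeasure lborel K"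
  unfolding hausdorff_measure_def
proof (rule SUP_least, rule ennreal_le_epsilon)
  fix \<delta> e :: real assume "\<delta> \<in> {0<..}" and e: "e > 0"
  then have \<delta>: "\<delta> > 0" by simp
  obtain U where U: "open U" "K \<subseteq> U" "emeasure lborel U \<le> emeasure lborel K + ennreal (e/2)"
    using open_superset_emeasure_le[of K "e/2"] K e by (auto simp: emeasure_completion borel_compact)
  let ?I0 = "{p. snd p \<le> \<delta> / 2 \<and> ball (fst p) (snd p) \<subseteq> U}"
  obtain C where C: "countable C" "C \<subseteq> ?I0"
      "pairwise (\<lambda>i j. disjnt (ball (fst i) (snd i)) (ball (fst j) (snd j))) C"
      "negligible (K - (\<Union>i\<in>C. ball (fst i) (snd i)))"
  proof (rule Vitali_covering_theorem_balls[of K ?I0 fst snd])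
    fix x and d :: real assume x: "x \<in> K" and d: "0 < d"
    obtain r where r: "r > 0" "ball x r \<subseteq> U" using U x by (meson open_contains_ball subsetD)
    \<comment> \<open>The three bounds keep the ball inside \<open>U\<close>, its radius below the
      prescribed \<open>d\<close>, and its diameter at most \<open>\<delta>\<close>.\<close>
    let ?r = "min (min r (d/2)) (\<delta>/2)"
    have "ball x ?r \<subseteq> ball x r" by auto
    then have "(x, ?r) \<in> ?I0 \<and> x \<in> ball (fst (x, ?r)) (snd (x, ?r)) \<and> snd (x, ?r) < d"
      using r d \<delta> by auto
    then show "\<exists>i. i \<in> ?I0 \<and> x \<in> ball (fst i) (snd i) \<and> snd i < d" by blast
  qed
  obtain D where D: "countable D" "\<And>p. p \<in> D \<Longrightarrow> snd p \<le> \<delta> / 2"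
      "K - (\<Union>i\<in>C. ball (fst i) (snd i)) \<subseteq> (\<Union>p\<in>D. ball (fst p) (snd p))"
      "(\<integral>\<^sup>+p. emeasure lborel (ball (fst p) (snd p)) \<partial>count_space D) \<le> ennreal (e/2)"
    using negligible_ball_cover[OF C(4), of "e/2" \<delta>] e \<delta> by auto
  have "hausdorff_content DIM('a) \<delta> K \<le> (\<integral>\<^sup>+p. emeasure lborel (ball (fst p) (snd p)) \<partial>count_space (C \<union> D))"
  proof (rule hausdorff_content_le_balls)
    show "snd p \<le> \<delta> / 2" if "p \<in> C \<union> D" for p
      using that C(2) D(2)[of p] by blast
    show "K \<subseteq> (\<Union>p\<in>C \<union> D. ball (fst p) (snd p))"
      using D(3) by blast
  qed (use C(1) D(1) \<delta> in auto)
  also have "\<dots> \<le> (\<integral>\<^sup>+p. emeasure lborel (ball (fst p) (snd p)) \<partial>count_space C)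
      + (\<integral>\<^sup>+p. emeasure lborel (ball (fst p) (snd p)) \<partial>count_space D)"
    by (rule nn_integral_count_space_Un_le)
  also have "\<dots> \<le> emeasure lborel U + ennreal (e/2)"
    using C U by (intro add_mono emeasure_disjoint_balls_le D) auto
  also have "emeasure lborel U + ennreal (e/2) \<le> emeasure lborel K + ennreal (e/2) + ennreal (e/2)"
    by (intro add_right_mono U)
  finally have "hausdorff_content DIM('a) \<delta> K \<le> emeasure lborel K + (ennreal (e/2) + ennreal (e/2))"
    by (simp add: add.assoc)
  then show "hausdorff_content DIM('a) \<delta> K \<le> emeasure lborel K + ennreal e"
    using e by (simp flip: ennreal_plus)
qed

theorem hausdorff_measure_eq_lebesgue:
  fixes K :: "'a::euclidean_space set"
  assumes "compact K"
  shows "hausdorff_measure DIM('a) K = emeasure lebesgue K"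
  using hausdorff_measure_le_emeasure[OF assms] emeasure_le_hausdorff_measure[of K] assms
  by (simp add: emeasure_completion borel_compact)

section \<open>Volumes of zonotopes\<close>

text \<open>Lists allow recursion over the generators.\<close>

definition zonotope_list :: "'a::euclidean_space list \<Rightarrow> 'a set" where
  "zonotope_list as = (\<Sum>a\<leftarrow>as. closed_segment 0 a)"

lemma zonotope_list_simps [simp]:
  "zonotope_list [] = {0}"
  "zonotope_list (a # as) = closed_segment 0 a + zonotope_list as"
  by (simp_all add: zonotope_list_def set_zero)

lemma zonotope_eq_zonotope_list:
  assumes "distinct xs" "set xs = UNIV"
  shows "zonotope a = zonotope_list (map a xs)"
  using assms by (simp add: zonotope_def zonotope_list_def sum.distinct_set_conv_list[symmetric] o_def)

lemma compact_set_plus: "compact (A + B)" if "compact A" "compact B" for A B :: "'a::euclidean_space set"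
proof -
  have "A + B = {x + y |x y. x \<in> A \<and> y \<in> B}" unfolding set_plus_def by blast
  then show ?thesis using compact_sums[OF that] by simp
qed

lemma convex_compact_zonotope_list: "convex (zonotope_list as) \<and> compact (zonotope_list as)"
  by (induction as) (auto intro: convex_set_plus compact_set_plus)

section \<open>Lengthening one generator\<close>

lemma set_plus_segment_iff:
  fixes X :: "'a::real_vector set"
  assumes "0 \<le> t"
  shows "y \<in> X + closed_segment 0 (t *\<^sub>R a) \<longleftrightarrow> (\<exists>x\<in>X. \<exists>r. 0 \<le> r \<and> r \<le> t \<and> y = x + r *\<^sub>R a)"
proof -
  have "z \<in> closed_segment 0 (t *\<^sub>R a) \<longleftrightarrow> (\<exists>r. 0 \<le> r \<and> r \<le> t \<and> z = r *\<^sub>R a)" for z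
  proof
    assume "z \<in> closed_segment 0 (t *\<^sub>R a)"
    then obtain u where "0 \<le> u" "u \<le> 1" "z = (u * t) *\<^sub>R a" by (auto simp: in_segment)
    then show "\<exists>r. 0 \<le> r \<and> r \<le> t \<and> z = r *\<^sub>R a"
      using assms by (intro exI[of _ "u * t"]) (auto simp: mult_left_le_one_le)
  next
    assume "\<exists>r. 0 \<le> r \<and> r \<le> t \<and> z = r *\<^sub>R a"
    then obtain r where r: "0 \<le> r" "r \<le> t" "z = r *\<^sub>R a" by blast
    then have "z = (r / t) *\<^sub>R (t *\<^sub>R a)" by (cases "t = 0") auto
    then show "z \<in> closed_segment 0 (t *\<^sub>R a)"
      using r assms unfolding in_segment by (intro exI[of _ "r / t"]) (auto simp: divide_simps)
  qed
  then have "y \<in> X + closed_segment 0 (t *\<^sub>R a) \<longleftrightarrow> (\<exists>x\<in>X. \<exists>z. (\<exists>r. 0 \<le> r \<and> r \<le> t \<and> z = r *\<^sub>R a) \<and> y = x + z)"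
    by (simp add: set_plus_def Bex_def)
  then show ?thesis by blast
qed

text \<open>Convexity makes the shifted layer new: if a point of it already lay in the shorter sum,
  \<open>x + r *\<^sub>R a\<close> would lie between two points of \<open>X\<close>, hence in
  \<open>X\<close>. Conversely, a point outside the shorter sum needs a coefficient above
  \<open>s\<close>, so subtracting \<open>s *\<^sub>R a\<close> leaves a valid coefficient.\<close>

lemma set_plus_segment_Diff:
  fixes X :: "'a::real_vector set"
  assumes X: "convex X" and st: "0 \<le> s" "0 \<le> t"
  shows "(X + closed_segment 0 ((s + t) *\<^sub>R a)) - (X + closed_segment 0 (s *\<^sub>R a))
      = (+) (s *\<^sub>R a) ` ((X + closed_segment 0 (t *\<^sub>R a)) - X)" (is "?L = ?R")
proof (intro set_eqI iffI)
  fix y assume y: "y \<in> ?L"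
  then obtain x r where x: "x \<in> X" "0 \<le> r" "r \<le> s + t" "y = x + r *\<^sub>R a"
    using st by (auto simp: set_plus_segment_iff)
  have "y \<notin> X + closed_segment 0 (s *\<^sub>R a)" using y by blast
  then have "r > s"
    using x unfolding set_plus_segment_iff[OF st(1)] by (metis linorder_not_less)
  then have "y - s *\<^sub>R a \<in> X + closed_segment 0 (t *\<^sub>R a)"
    using x st unfolding set_plus_segment_iff[OF st(2)]
    by (intro bexI[of _ x] exI[of _ "r - s"]) (auto simp: algebra_simps)
  moreover have "y - s *\<^sub>R a \<notin> X"
  proof
    assume "y - s *\<^sub>R a \<in> X"
    then have "y \<in> X + closed_segment 0 (s *\<^sub>R a)"
      using st unfolding set_plus_segment_iff[OF st(1)]
      by (intro bexI[of _ "y - s *\<^sub>R a"] exI[of _ s]) auto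
    then show False using y by blast
  qed
  ultimately show "y \<in> ?R"
    by (intro image_eqI[of _ _ "y - s *\<^sub>R a"]) auto
next
  fix y assume "y \<in> ?R"
  then obtain x r where x: "x \<in> X" "0 \<le> r" "r \<le> t" "y = s *\<^sub>R a + (x + r *\<^sub>R a)" "x + r *\<^sub>R a \<notin> X"
    using st by (auto simp: set_plus_segment_iff)
  have "y \<in> X + closed_segment 0 ((s + t) *\<^sub>R a)"
    unfolding set_plus_segment_iff[OF add_nonneg_nonneg[OF st]] using x st
    by (intro bexI[of _ x] exI[of _ "s + r"]) (auto simp: algebra_simps)
  moreover have "y \<notin> X + closed_segment 0 (s *\<^sub>R a)"
  proof
    assume "y \<in> X + closed_segment 0 (s *\<^sub>R a)"
    then obtain x' q where x': "x' \<in> X" "0 \<le> q" "q \<le> s" "y = x' + q *\<^sub>R a"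
      using st by (auto simp: set_plus_segment_iff)
    have x'_eq: "x' = x + (r + (s - q)) *\<^sub>R a"
      using x x' by (simp add: algebra_simps)
    have "r > 0" using x by (cases "r = 0") auto
    then have p: "r + (s - q) > 0" using x' by simp
    \<comment> \<open>The position of \<open>x + r *\<^sub>R a\<close> on the segment from
      \<open>x\<close> to \<open>x'\<close>.\<close>
    define c where "c = r / (r + (s - q))"
    have "(1 - c) *\<^sub>R x + c *\<^sub>R x' = x + (c * (r + (s - q))) *\<^sub>R a"
      unfolding x'_eq by (simp add: scaleR_add_right scaleR_left_diff_distrib)
    also have "c * (r + (s - q)) = r" using p by (simp add: c_def)
    finally have "x + r *\<^sub>R a = (1 - c) *\<^sub>R x + c *\<^sub>R x'" by simp
    moreover have "0 \<le> c" "c \<le> 1" using p \<open>r > 0\<close> x' by (auto simp: c_def)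
    ultimately have "x + r *\<^sub>R a \<in> X"
      using convexD_alt[OF X x(1) x'(1)] by simp
    then show False using x by blast
  qed
  ultimately show "y \<in> ?L" by blast
qed

text \<open>The layers gained from length 0 to 1 and from 1 to 2 are translates of each other.
  Affinity in the length enters the argument only in this form.\<close>

lemma measure_plus_double_segment:
  fixes X :: "'a::euclidean_space set"
  assumes X: "convex X" "compact X"
  shows "measure lebesgue (X + closed_segment 0 (2 *\<^sub>R a)) - measure lebesgue X
      = 2 * (measure lebesgue (X + closed_segment 0 a) - measure lebesgue X)"
proof -
  let ?X = "\<lambda>t. X + closed_segment 0 (t *\<^sub>R a)"
  have m: "?X t \<in> lmeasurable" for t
    by (intro lmeasurable_compact compact_set_plus X compact_segment)
  have m0: "X \<in> lmeasurable" using X by (simp add: lmeasurable_compact)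
  have sub1: "X \<subseteq> ?X 1"
  proof
    fix x assume "x \<in> X"
    then show "x \<in> ?X 1"
      by (subst set_plus_segment_iff) (auto intro!: bexI[of _ x] exI[of _ 0])
  qed
  have sub2: "?X 1 \<subseteq> ?X 2"
  proof
    fix y assume "y \<in> ?X 1"
    then obtain x r where "x \<in> X" "0 \<le> r" "r \<le> 1" "y = x + r *\<^sub>R a"
      by (subst (asm) set_plus_segment_iff) auto
    then show "y \<in> ?X 2"
      by (subst set_plus_segment_iff) (auto intro!: bexI[of _ x] exI[of _ r])
  qed
  have "measure lebesgue (?X 2 - ?X 1) = measure lebesgue (?X 1 - X)"
    using set_plus_segment_Diff[of X 1 1 a] X measure_translation[of a "?X 1 - X"] by simp
  then have "measure lebesgue (?X 2) - measure lebesgue (?X 1) = measure lebesgue (?X 1) - measure lebesgue X"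
    using measurable_measure_Diff[OF m fmeasurableD[OF m] sub2] measurable_measure_Diff[OF m fmeasurableD[OF m0] sub1]
    by simp
  then show ?thesis by simp
qed

text \<open>At \<open>{0}\<close> this is the coefficient of the product of the lengths of \<open>bs\<close> in the volume of a
  zonotope as a polynomial in the lengths of its generators.\<close>

fun volume_diff :: "'a::euclidean_space list \<Rightarrow> 'a set \<Rightarrow> real" where
  "volume_diff [] X = measure lebesgue X"
| "volume_diff (b # bs) X = volume_diff bs (X + closed_segment 0 b) - volume_diff bs X"

section \<open>Multilinearity and homogeneity of the volume\<close>

text \<open>Adding a segment keeps convexity and compactness, and sums of segments commute, so the
  induction hypothesis applies to both terms of the difference.\<close>

lemma volume_diff_plus_double_segment:
  assumes "convex X" "compact X"
  shows "volume_diff bs (X + closed_segment 0 (2 *\<^sub>R a)) - volume_diff bs X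
      = 2 * (volume_diff bs (X + closed_segment 0 a) - volume_diff bs X)"
  using assms
proof (induction bs arbitrary: X)
  case Nil
  then show ?case by (simp add: measure_plus_double_segment)
next
  case (Cons b bs)
  have "convex (X + closed_segment 0 b)" "compact (X + closed_segment 0 b)"
    using Cons.prems by (auto intro: convex_set_plus compact_set_plus)
  from Cons.IH[OF this] Cons.IH[OF Cons.prems] show ?case
    by (simp add: add.assoc add.commute[of "closed_segment 0 b"])
qed

lemma volume_diff_double_map:
  assumes "convex X" "compact X"
  shows "volume_diff (map ((*\<^sub>R) 2) bs) X = 2 ^ length bs * volume_diff bs X"
  using assms
proof (induction bs arbitrary: X)
  case (Cons b bs)
  have "convex (X + closed_segment 0 (2 *\<^sub>R b))" "compact (X + closed_segment 0 (2 *\<^sub>R b))"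
    using Cons.prems by (auto intro: convex_set_plus compact_set_plus)
  then have "volume_diff (map ((*\<^sub>R) 2) (b # bs)) X
      = 2 ^ length bs * (volume_diff bs (X + closed_segment 0 (2 *\<^sub>R b)) - volume_diff bs X)"
    using Cons by (simp add: algebra_simps)
  also have "\<dots> = 2 ^ length bs * (2 * (volume_diff bs (X + closed_segment 0 b) - volume_diff bs X))"
    by (simp only: volume_diff_plus_double_segment[OF Cons.prems])
  finally show ?case by simp
qed simp

text \<open>Here the set is scaled along with the generators, so the factor comes from the dimension
  of the space and not from the number of generators.\<close>

lemma volume_diff_double:
  fixes bs :: "'a::euclidean_space list"
  shows "volume_diff (map ((*\<^sub>R) 2) bs) ((*\<^sub>R) 2 ` X) = 2 ^ DIM('a) * volume_diff bs X"
proof (induction bs arbitrary: X)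
  case Nil
  then show ?case using measure_lebesgue_affine[of 2 0 X] by simp
next
  case (Cons b bs)
  have seg: "closed_segment 0 (2 *\<^sub>R b) = (*\<^sub>R) 2 ` closed_segment 0 b"
    using closed_segment_linear_image[of "(*\<^sub>R) 2" 0 b] by simp
  have "(*\<^sub>R) 2 ` X + closed_segment 0 (2 *\<^sub>R b) = (*\<^sub>R) 2 ` (X + closed_segment 0 b)"
    unfolding seg by (force simp: set_plus_def scaleR_add_right)
  then show ?case using Cons by (simp add: algebra_simps)
qed

text \<open>Scaling fixes \<open>{0}\<close>, so doubling all generators gives both the factor
  \<open>2 ^ length bs\<close>, by multilinearity, and the factor \<open>2 ^ DIM('a)\<close>, by
  homogeneity.\<close>

lemma volume_diff_eq_0:
  fixes bs :: "'a::euclidean_space list"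
  assumes "length bs \<noteq> DIM('a)"
  shows "volume_diff bs {0} = 0"
proof -
  have "2 ^ length bs * volume_diff bs {0} = 2 ^ DIM('a) * volume_diff bs {0}"
    using volume_diff_double[of bs "{0}"] volume_diff_double_map[of "{0}" bs] by simp
  then show ?thesis using assms by simp
qed

text \<open>The volume with a generator is the difference plus the volume without it; a sublist
  records at which generators the difference is taken.\<close>

lemma measure_plus_zonotope_list:
  "measure lebesgue (X + zonotope_list as) = (\<Sum>cs\<leftarrow>subseqs as. volume_diff cs X)"
proof (induction as arbitrary: X)
  case Nil
  then show ?case by simp
next
  case (Cons a as)
  have "measure lebesgue (X + zonotope_list (a # as)) = (\<Sum>cs\<leftarrow>subseqs as. volume_diff cs (X + closed_segment 0 a))"
    using Cons.IH[of "X + closed_segment 0 a"] by (simp add: add.assoc)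
  also have "\<dots> = (\<Sum>cs\<leftarrow>subseqs as. volume_diff (a # cs) X + volume_diff cs X)"
    by simp
  also have "\<dots> = (\<Sum>cs\<leftarrow>subseqs (a # as). volume_diff cs X)"
    by (simp only: sum_list_addf) (simp add: Let_def o_def)
  finally show ?case .
qed

section \<open>Reduction to parallelepipeds\<close>

text \<open>Choices of positions, in a form that evaluates by rewriting; equal entries at different
  positions count separately.\<close>

fun sublists_of_length :: "nat \<Rightarrow> 'a list \<Rightarrow> 'a list list" where
  "sublists_of_length 0 xs = [[]]"
| "sublists_of_length (Suc n) [] = []"
| "sublists_of_length (Suc n) (x # xs) = map ((#) x) (sublists_of_length n xs) @ sublists_of_length (Suc n) xs"

lemma sum_list_subseqs_length:
  fixes f :: "'a list \<Rightarrow> 'b::comm_monoid_add"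
  assumes "\<And>cs. length cs \<noteq> n \<Longrightarrow> f cs = 0"
  shows "(\<Sum>cs\<leftarrow>subseqs xs. f cs) = (\<Sum>cs\<leftarrow>sublists_of_length n xs. f cs)"
  using assms
proof (induction n xs arbitrary: f rule: sublists_of_length.induct)
  case (1 xs)
  then have "(\<Sum>cs\<leftarrow>subseqs xs. f cs) = f []"
    by (induction xs) (auto simp: Let_def o_def)
  then show ?case by simp
next
  case (3 n x xs)
  have "(\<Sum>cs\<leftarrow>subseqs xs. f (x # cs)) = (\<Sum>cs\<leftarrow>sublists_of_length n xs. f (x # cs))"
    by (rule "3.IH"(1)) (auto intro: 3)
  moreover have "(\<Sum>cs\<leftarrow>subseqs xs. f cs) = (\<Sum>cs\<leftarrow>sublists_of_length (Suc n) xs. f cs)"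
    by (rule "3.IH"(2)) (auto intro: 3)
  ultimately show ?case by (simp add: Let_def o_def)
qed simp

lemma sublists_of_length_longer: "length xs < n \<Longrightarrow> sublists_of_length n xs = []"
  by (induction n xs rule: sublists_of_length.induct) auto

lemma sublists_of_length_length: "sublists_of_length (length xs) xs = [xs]"
  by (induction xs) (auto simp: sublists_of_length_longer)

lemma length_sublists_of_length: "cs \<in> set (sublists_of_length n xs) \<Longrightarrow> length cs = n"
  by (induction n xs arbitrary: cs rule: sublists_of_length.induct) auto

text \<open>Only sublists of length \<open>DIM('a)\<close> contribute. Such a list is its own only
  sublist of that length, so the same formula applied to it identifies its coefficient with its
  volume.\<close>

theorem measure_zonotope_list:
  fixes as :: "'a::euclidean_space list"
  shows "measure lebesgue (zonotope_list as)
    = (\<Sum>cs\<leftarrow>sublists_of_length DIM('a) as. measure lebesgue (zonotope_list cs))"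
proof -
  have *: "measure lebesgue (zonotope_list xs) = (\<Sum>cs\<leftarrow>sublists_of_length DIM('a) xs. volume_diff cs {0})"
    for xs :: "'a list"
    using measure_plus_zonotope_list[of "{0}" xs] sum_list_subseqs_length[of "DIM('a)" "\<lambda>cs. volume_diff cs {0}" xs]
    by (simp add: volume_diff_eq_0)
  have "volume_diff cs {0} = measure lebesgue (zonotope_list cs)"
    if "cs \<in> set (sublists_of_length DIM('a) as)" for cs
  proof -
    have "sublists_of_length DIM('a) cs = [cs]"
      using sublists_of_length_length[of cs] by (simp only: length_sublists_of_length[OF that])
    then show ?thesis unfolding *[of cs] by simp
  qed
  then show ?thesis
    unfolding *[of as] by (intro arg_cong[of _ _ sum_list] map_cong) auto
qed

section \<open>Parallelepipeds and determinants\<close>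

lemma zonotope_columns: "zonotope (\<lambda>j. column j A) = (*v) A ` cbox 0 1"
  for A :: "real^'n^'n"
proof -
  have "finite (UNIV :: 'n set)" by simp
  then have "zonotope (\<lambda>j. column j A) = {(\<Sum>j\<in>UNIV. y j) |y. \<forall>j\<in>UNIV. y j \<in> closed_segment 0 (column j A)}"
    unfolding zonotope_def by (rule set_sum_alt)
  also have "\<dots> = (*v) A ` cbox 0 1"
  proof (intro set_eqI iffI)
    fix z assume "z \<in> {(\<Sum>j\<in>UNIV. y j) |y. \<forall>j\<in>UNIV. y j \<in> closed_segment 0 (column j A)}"
    then obtain y where y: "z = (\<Sum>j\<in>UNIV. y j)" "\<forall>j. y j \<in> closed_segment 0 (column j A)" by auto
    then obtain u where u: "\<And>j. 0 \<le> u j \<and> u j \<le> 1 \<and> y j = u j *\<^sub>R column j A"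
      unfolding in_segment by (auto, metis)
    have "z = A *v (\<chi> j. u j)"
      using u y by (simp add: matrix_mult_sum vector_scalar_mult_def scaleR_vec_def)
    moreover have "(\<chi> j. u j) \<in> cbox 0 1" using u by (simp add: mem_box_cart)
    ultimately show "z \<in> (*v) A ` cbox 0 1" by blast
  next
    fix z assume "z \<in> (*v) A ` cbox 0 1"
    then obtain x where x: "x \<in> cbox 0 1" "z = A *v x" by blast
    have "z = (\<Sum>j\<in>UNIV. (x $ j) *\<^sub>R column j A)"
      using x by (simp add: matrix_mult_sum vector_scalar_mult_def scaleR_vec_def)
    moreover have "(x $ j) *\<^sub>R column j A \<in> closed_segment 0 (column j A)" for j
      using x by (auto simp: in_segment mem_box_cart)
    ultimately show "z \<in> {(\<Sum>j\<in>UNIV. y j) |y. \<forall>j\<in>UNIV. y j \<in> closed_segment 0 (column j A)}" by blast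
  qed
  finally show ?thesis .
qed

lemma measure_zonotope_columns:
  fixes A :: "((real, 'n) vec, 'n::{finite,wellorder}) vec"
  shows "measure lebesgue (zonotope (\<lambda>j. column j A)) = \<bar>det A\<bar>"
proof -
  have "measure lebesgue (cbox 0 1 :: ((real, 'n) vec) set) = 1"
    by (simp add: measure_completion content_cbox_cart interval_ne_empty_cart)
  then show ?thesis
    unfolding zonotope_columns
    by (subst measure_linear_image) (auto simp: matrix_vector_mul_linear matrix_of_matrix_vector_mul)
qed

lemma vector_4:
  "(vector [a, b, c, d] :: 'a::zero^4) $ 1 = a" "(vector [a, b, c, d] :: 'a::zero^4) $ 2 = b"
  "(vector [a, b, c, d] :: 'a::zero^4) $ 3 = c" "(vector [a, b, c, d] :: 'a::zero^4) $ 4 = d"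
  unfolding vector_def by simp_all

lemma vector_5:
  "(vector [a, b, c, d, e] :: 'a::zero^5) $ 1 = a" "(vector [a, b, c, d, e] :: 'a::zero^5) $ 2 = b"
  "(vector [a, b, c, d, e] :: 'a::zero^5) $ 3 = c" "(vector [a, b, c, d, e] :: 'a::zero^5) $ 4 = d"
  "(vector [a, b, c, d, e] :: 'a::zero^5) $ 5 = e"
  unfolding vector_def by simp_all

lemma UNIV_5: "UNIV = {1, 2, 3, 4, 5::5}"
  by (rule card_subset_eq[symmetric]) auto

lemma UNIV_6: "UNIV = {1, 2, 3, 4, 5, 6::6}"
  by (rule card_subset_eq[symmetric]) auto

lemma UNIV_7: "UNIV = {1, 2, 3, 4, 5, 6, 7::7}"
  by (rule card_subset_eq[symmetric]) auto

lemma det_4: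
  "det (A::'a::comm_ring_1^4^4) = A$1$1 * A$2$2 * A$3$3 * A$4$4 - A$1$1 * A$2$2 * A$3$4 * A$4$3 - A$1$1 * A$2$3 * A$3$2 * A$4$4 + A$1$1 * A$2$3 * A$3$4 * A$4$2 + A$1$1 * A$2$4 * A$3$2 * A$4$3 - A$1$1 * A$2$4 * A$3$3 * A$4$2 - A$1$2 * A$2$1 * A$3$3 * A$4$4 + A$1$2 * A$2$1 * A$3$4 * A$4$3 + A$1$2 * A$2$3 * A$3$1 * A$4$4 - A$1$2 * A$2$3 * A$3$4 * A$4$1 - A$1$2 * A$2$4 * A$3$1 * A$4$3 + A$1$2 * A$2$4 * A$3$3 * A$4$1 + A$1$3 * A$2$1 * A$3$2 * A$4$4 - A$1$3 * A$2$1 * A$3$4 * A$4$2 - A$1$3 * A$2$2 * A$3$1 * A$4$4 + A$1$3 * A$2$2 * A$3$4 * A$4$1 + A$1$3 * A$2$4 * A$3$1 * A$4$2 - A$1$3 * A$2$4 * A$3$2 * A$4$1 - A$1$4 * A$2$1 * A$3$2 * A$4$3 + A$1$4 * A$2$1 * A$3$3 * A$4$2 + A$1$4 * A$2$2 * A$3$1 * A$4$3 - A$1$4 * A$2$2 * A$3$3 * A$4$1 - A$1$4 * A$2$3 * A$3$1 * A$4$2 + A$1$4 * A$2$3 * A$3$2 * A$4$1"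
proof -
  have f: "finite {2::4, 3, 4}" "1 \<notin> {2::4, 3, 4}" "finite {3::4, 4}" "2 \<notin> {3::4, 4}" "finite {4::4}" "3 \<notin> {4::4}"
    by auto
  show ?thesis
    unfolding det_def UNIV_4
    unfolding sum_over_permutations_insert[OF f(1,2)]
    unfolding sum_over_permutations_insert[OF f(3,4)]
    unfolding sum_over_permutations_insert[OF f(5,6)]
    unfolding permutes_sing
    by (simp add: sign_swap_id permutation_swap_id permutation_compose sign_compose sign_id swap_id_eq)
qed

text \<open>Laplace expansion along successive rows: in this nested form a zero entry removes a
  whole cofactor.\<close>

lemma det_5:
  "det (A::'a::comm_ring_1^5^5) = A$1$1 * (A$2$2 * (A$3$3 * (A$4$4 * (A$5$5) - A$4$5 * (A$5$4)) - A$3$4 * (A$4$3 * (A$5$5) - A$4$5 * (A$5$3)) + A$3$5 * (A$4$3 * (A$5$4) - A$4$4 * (A$5$3))) - A$2$3 * (A$3$2 * (A$4$4 * (A$5$5) - A$4$5 * (A$5$4)) - A$3$4 * (A$4$2 * (A$5$5) - A$4$5 * (A$5$2)) + A$3$5 * (A$4$2 * (A$5$4) - A$4$4 * (A$5$2))) + A$2$4 * (A$3$2 * (A$4$3 * (A$5$5) - A$4$5 * (A$5$3)) - A$3$3 * (A$4$2 * (A$5$5) - A$4$5 * (A$5$2)) + A$3$5 * (A$4$2 * (A$5$3) - A$4$3 * (A$5$2))) - A$2$5 * (A$3$2 * (A$4$3 * (A$5$4) - A$4$4 * (A$5$3)) - A$3$3 * (A$4$2 * (A$5$4) - A$4$4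 * (A$5$2)) + A$3$4 * (A$4$2 * (A$5$3) - A$4$3 * (A$5$2)))) - A$1$2 * (A$2$1 * (A$3$3 * (A$4$4 * (A$5$5) - A$4$5 * (A$5$4)) - A$3$4 * (A$4$3 * (A$5$5) - A$4$5 * (A$5$3)) + A$3$5 * (A$4$3 * (A$5$4) - A$4$4 * (A$5$3))) - A$2$3 * (A$3$1 * (A$4$4 * (A$5$5) - A$4$5 * (A$5$4)) - A$3$4 * (A$4$1 * (A$5$5) - A$4$5 * (A$5$1)) + A$3$5 * (A$4$1 * (A$5$4) - A$4$4 * (A$5$1))) + A$2$4 * (A$3$1 * (A$4$3 * (A$5$5) - A$4$5 * (A$5$3)) - A$3$3 * (A$4$1 * (A$5$5) - A$4$5 * (A$5$1)) + A$3$5 * (A$4$1 * (A$5$3) - A$4$3 * (A$5$1))) - A$2$5 * (A$3$1 * (A$4$3 * (A$5$4) - A$4$4 * (A$5$3)) - A$3$3 * (A$4$1 * (A$5$4) - A$4$4 * (A$5$1)) + A$3$4 * (A$4$1 * (A$5$3) - A$4$3 * (A$5$1)))) + A$1$3 * (A$2$1 * (A$3$2 * (A$4$4 * (A$5$5) - A$4$5 * (A$5$4)) - A$3$4 * (A$4$2 * (A$5$5) - A$4$5 * (A$5$2)) + A$3$5 * (A$4$2 * (A$5$4) - A$4$4 * (A$5$2))) - A$2$2 * (A$3$1 * (A$4$4 * (A$5$5) - A$4$5 * (A$5$4)) - A$3$4 * (A$4$1 * (A$5$5) - A$4$5 * (A$5$1)) + A$3$5 * (A$4$1 * (A$5$4)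 - A$4$4 * (A$5$1))) + A$2$4 * (A$3$1 * (A$4$2 * (A$5$5) - A$4$5 * (A$5$2)) - A$3$2 * (A$4$1 * (A$5$5) - A$4$5 * (A$5$1)) + A$3$5 * (A$4$1 * (A$5$2) - A$4$2 * (A$5$1))) - A$2$5 * (A$3$1 * (A$4$2 * (A$5$4) - A$4$4 * (A$5$2)) - A$3$2 * (A$4$1 * (A$5$4) - A$4$4 * (A$5$1)) + A$3$4 * (A$4$1 * (A$5$2) - A$4$2 * (A$5$1)))) - A$1$4 * (A$2$1 * (A$3$2 * (A$4$3 * (A$5$5) - A$4$5 * (A$5$3)) - A$3$3 * (A$4$2 * (A$5$5) - A$4$5 * (A$5$2)) + A$3$5 * (A$4$2 * (A$5$3) - A$4$3 * (A$5$2))) - A$2$2 * (A$3$1 * (A$4$3 * (A$5$5) - A$4$5 * (A$5$3)) - A$3$3 * (A$4$1 * (A$5$5) - A$4$5 * (A$5$1)) + A$3$5 * (A$4$1 * (A$5$3) - A$4$3 * (A$5$1))) + A$2$3 * (A$3$1 * (A$4$2 * (A$5$5) - A$4$5 * (A$5$2)) - A$3$2 * (A$4$1 * (A$5$5) - A$4$5 * (A$5$1)) + A$3$5 * (A$4$1 * (A$5$2) - A$4$2 * (A$5$1))) - A$2$5 * (A$3$1 * (A$4$2 * (A$5$3) - A$4$3 * (A$5$2)) - A$3$2 * (A$4$1 * (A$5$3) - A$4$3 * (A$5$1)) + A$3$3 * (A$4$1 * (A$5$2) - A$4$2 * (A$5$1)))) + A$1$5 * (A$2$1 * (A$3$2 *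 (A$4$3 * (A$5$4) - A$4$4 * (A$5$3)) - A$3$3 * (A$4$2 * (A$5$4) - A$4$4 * (A$5$2)) + A$3$4 * (A$4$2 * (A$5$3) - A$4$3 * (A$5$2))) - A$2$2 * (A$3$1 * (A$4$3 * (A$5$4) - A$4$4 * (A$5$3)) - A$3$3 * (A$4$1 * (A$5$4) - A$4$4 * (A$5$1)) + A$3$4 * (A$4$1 * (A$5$3) - A$4$3 * (A$5$1))) + A$2$3 * (A$3$1 * (A$4$2 * (A$5$4) - A$4$4 * (A$5$2)) - A$3$2 * (A$4$1 * (A$5$4) - A$4$4 * (A$5$1)) + A$3$4 * (A$4$1 * (A$5$2) - A$4$2 * (A$5$1))) - A$2$4 * (A$3$1 * (A$4$2 * (A$5$3) - A$4$3 * (A$5$2)) - A$3$2 * (A$4$1 * (A$5$3) - A$4$3 * (A$5$1)) + A$3$3 * (A$4$1 * (A$5$2) - A$4$2 * (A$5$1))))"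
proof -
  have f: "finite {2::5, 3, 4, 5}" "1 \<notin> {2::5, 3, 4, 5}" "finite {3::5, 4, 5}" "2 \<notin> {3::5, 4, 5}"
    "finite {4::5, 5}" "3 \<notin> {4::5, 5}" "finite {5::5}" "4 \<notin> {5::5}"
    by auto
  show ?thesis
    unfolding det_def UNIV_5
    unfolding sum_over_permutations_insert[OF f(1,2)]
    unfolding sum_over_permutations_insert[OF f(3,4)]
    unfolding sum_over_permutations_insert[OF f(5,6)]
    unfolding sum_over_permutations_insert[OF f(7,8)]
    unfolding permutes_sing
    by (simp add: sign_swap_id permutation_swap_id permutation_compose sign_compose sign_id swap_id_eq algebra_simps)
qed

section \<open>Projections of zonotopes\<close>

lemma measure_zonotope_rows:
  fixes A :: "((real, 'n) vec, 'n::{finite,wellorder}) vec"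
  shows "measure lebesgue (zonotope (\<lambda>j. A $ j)) = \<bar>det A\<bar>"
  using measure_zonotope_columns[of "transpose A"] by (simp add: column_transpose row_def det_transpose)

lemma measure_zonotope_list_det:
  "measure lebesgue (zonotope_list [a, b :: real^2]) = \<bar>det (vector [a, b] :: real^2^2)\<bar>"
  "measure lebesgue (zonotope_list [c, d, e :: real^3]) = \<bar>det (vector [c, d, e] :: real^3^3)\<bar>"
  "measure lebesgue (zonotope_list [f, g, h, k :: real^4]) = \<bar>det (vector [f, g, h, k] :: real^4^4)\<bar>"
  "measure lebesgue (zonotope_list [l, m, n, p, q :: real^5]) = \<bar>det (vector [l, m, n, p, q] :: real^5^5)\<bar>"
proof -
  have "distinct [1, 2 :: 2]"
    by simp
  moreover have "set [1, 2 :: 2] = UNIV"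
    by (simp only: UNIV_2 list.set)
  ultimately have "zonotope_list [a, b] = zonotope (\<lambda>j. (vector [a, b] :: real^2^2) $ j)"
    by (simp only: zonotope_eq_zonotope_list list.map vector_2)
  then have "measure lebesgue (zonotope_list [a, b]) = measure lebesgue (zonotope (\<lambda>j. (vector [a, b] :: real^2^2) $ j))"
    by (rule arg_cong)
  also note measure_zonotope_rows
  finally show "measure lebesgue (zonotope_list [a, b]) = \<bar>det (vector [a, b] :: real^2^2)\<bar>" .
  have "distinct [1, 2, 3 :: 3]"
    by simp
  moreover have "set [1, 2, 3 :: 3] = UNIV"
    by (simp only: UNIV_3 list.set)
  ultimately have "zonotope_list [c, d, e] = zonotope (\<lambda>j. (vector [c, d, e] :: real^3^3) $ j)"
    by (simp only: zonotope_eq_zonotope_list list.map vector_3)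
  then have "measure lebesgue (zonotope_list [c, d, e]) = measure lebesgue (zonotope (\<lambda>j. (vector [c, d, e] :: real^3^3) $ j))"
    by (rule arg_cong)
  also note measure_zonotope_rows
  finally show "measure lebesgue (zonotope_list [c, d, e]) = \<bar>det (vector [c, d, e] :: real^3^3)\<bar>" .
  have "distinct [1, 2, 3, 4 :: 4]"
    by simp
  moreover have "set [1, 2, 3, 4 :: 4] = UNIV"
    by (simp only: UNIV_4 list.set)
  ultimately have "zonotope_list [f, g, h, k] = zonotope (\<lambda>j. (vector [f, g, h, k] :: real^4^4) $ j)"
    by (simp only: zonotope_eq_zonotope_list list.map vector_4)
  then have "measure lebesgue (zonotope_list [f, g, h, k]) = measure lebesgue (zonotope (\<lambda>j. (vector [f, g, h, k] :: real^4^4) $ j))"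
    by (rule arg_cong)
  also note measure_zonotope_rows
  finally show "measure lebesgue (zonotope_list [f, g, h, k]) = \<bar>det (vector [f, g, h, k] :: real^4^4)\<bar>" .
  have "distinct [1, 2, 3, 4, 5 :: 5]"
    by simp
  moreover have "set [1, 2, 3, 4, 5 :: 5] = UNIV"
    by (simp only: UNIV_5 list.set)
  ultimately have "zonotope_list [l, m, n, p, q] = zonotope (\<lambda>j. (vector [l, m, n, p, q] :: real^5^5) $ j)"
    by (simp only: zonotope_eq_zonotope_list list.map vector_5)
  then have "measure lebesgue (zonotope_list [l, m, n, p, q]) = measure lebesgue (zonotope (\<lambda>j. (vector [l, m, n, p, q] :: real^5^5) $ j))"
    by (rule arg_cong)
  also note measure_zonotope_rows
  finally show "measure lebesgue (zonotope_list [l, m, n, p, q]) = \<bar>det (vector [l, m, n, p, q] :: real^5^5)\<bar>" .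
qed

lemma emeasure_zonotope_list:
  "emeasure lebesgue (zonotope_list as) = ennreal (measure lebesgue (zonotope_list as))"
  using convex_compact_zonotope_list[of as] by (intro emeasure_eq_measure2 lmeasurable_compact) simp

lemma zonotope_list_linear_image:
  assumes "linear f"
  shows "zonotope_list (map f as) = f ` zonotope_list as"
proof (induction as)
  case Nil
  then show ?case using linear_0[OF assms] by simp
next
  case (Cons a as)
  have "closed_segment 0 (f a) = f ` closed_segment 0 a"
    using closed_segment_linear_image[OF assms, of 0 a] linear_0[OF assms] by simp
  moreover have "f ` (S + T) = f ` S + f ` T" for S T
    by (force simp: set_plus_def linear_add[OF assms])
  ultimately show ?case using Cons by simp
qed

text \<open>The last conjunct says that the orthonormal rows span \<open>E\<close>; then \<open>W\<close> maps a vector to the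
  coordinates of its projection onto \<open>E\<close>.\<close>

definition orthonormal_rows :: "real^'n^'m \<Rightarrow> (real^'n) set \<Rightarrow> bool" where
  "orthonormal_rows W E \<longleftrightarrow> W ** transpose W = mat 1 \<and> (\<forall>i. W $ i \<in> E) \<and>
     (\<forall>z\<in>E. transpose W *v (W *v z) = z)"

lemma transpose_mult_inner: "(transpose W *v y) \<bullet> z = y \<bullet> (W *v z)" for W :: "real^'n^'m"
  by (simp add: dot_lmul_matrix)

text \<open>The candidate lies in \<open>E\<close> as a combination of the rows, and the remainder
  is orthogonal to \<open>E\<close> because the rows span it.\<close>

lemma orth_proj_eq:
  assumes W: "orthonormal_rows W E" and E: "subspace E"
  shows "orth_proj E x = transpose W *v (W *v x)"
  unfolding orth_proj_def
proof (rule the_equality)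
  have "transpose W *v y = (\<Sum>i\<in>UNIV. y $ i *\<^sub>R W $ i)" for y
    by (simp add: vec_eq_iff matrix_vector_mult_def transpose_def mult.commute)
  then have in_E: "transpose W *v y \<in> E" for y
    using W E by (auto simp: orthonormal_rows_def intro!: subspace_sum subspace_scale)
  moreover have "x - transpose W *v (W *v x) \<in> E\<^sup>\<bottom>"
    unfolding orthogonal_comp_def orthogonal_def
  proof (intro CollectI ballI)
    fix z assume "z \<in> E"
    then have z: "z = transpose W *v (W *v z)" using W by (simp add: orthonormal_rows_def)
    have "(transpose W *v (W *v x)) \<bullet> z = (transpose W *v (W *v z)) \<bullet> x"
      unfolding transpose_mult_inner by (rule inner_commute)
    also have "\<dots> = z \<bullet> x" unfolding z[symmetric] ..
    finally show "z \<bullet> (x - transpose W *v (W *v x)) = 0"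
      by (simp only: inner_diff_right inner_commute[of z] diff_self)
  qed
  ultimately show "transpose W *v (W *v x) \<in> E \<and> x - transpose W *v (W *v x) \<in> E\<^sup>\<bottom>" by simp
  fix y assume y: "y \<in> E \<and> x - y \<in> E\<^sup>\<bottom>"
  let ?d = "y - transpose W *v (W *v x)"
  have dE: "?d \<in> E" using y in_E E by (simp add: subspace_diff)
  \<comment> \<open>Both remainders are orthogonal to \<open>?d\<close>, and so is their difference,
    which is \<open>?d\<close> itself.\<close>
  have "?d \<bullet> (x - transpose W *v (W *v x)) = 0" "?d \<bullet> (x - y) = 0"
    using dE y \<open>x - transpose W *v (W *v x) \<in> E\<^sup>\<bottom>\<close> unfolding orthogonal_comp_def orthogonal_def by blast+
  then have "?d \<bullet> ((x - transpose W *v (W *v x)) - (x - y)) = 0"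
    by (simp only: inner_diff_right[of ?d "x - transpose W *v (W *v x)"] diff_self)
  then have "?d \<bullet> ?d = 0" by (simp only: diff_diff_eq2 diff_add_eq add_diff_cancel_left' add.commute[of x] add_diff_cancel_right' diff_diff_add) simp
  then show "y = transpose W *v (W *v x)" by simp
qed

text \<open>\<open>transpose W\<close> embeds the coordinate space isometrically and maps the
  coordinates of the projection to the projection. In the coordinate space Hausdorff measure is
  Lebesgue measure.\<close>

lemma hausdorff_measure_orth_proj_zonotope_list:
  fixes W :: "real^'n^'m"
  assumes W: "orthonormal_rows W E" and E: "subspace E"
  shows "hausdorff_measure CARD('m) (orth_proj E ` zonotope_list as)
    = ennreal (measure lebesgue (zonotope_list (map ((*v) W) as)))"
proof -
  have "orth_proj E ` zonotope_list as = (*v) (transpose W) ` (*v) W ` zonotope_list as"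
    by (simp add: orth_proj_eq[OF W E] image_image)
  also have "(*v) W ` zonotope_list as = zonotope_list (map ((*v) W) as)"
    by (simp add: zonotope_list_linear_image matrix_vector_mul_linear)
  also have "hausdorff_measure CARD('m) ((*v) (transpose W) ` zonotope_list (map ((*v) W) as))
      = hausdorff_measure CARD('m) (zonotope_list (map ((*v) W) as))"
  proof (rule hausdorff_measure_isometry)
    fix x y :: "real^'m"
    have "(transpose W *v z) \<bullet> (transpose W *v z) = z \<bullet> z" for z
      unfolding transpose_mult_inner matrix_vector_mul_assoc using W by (simp only: orthonormal_rows_def matrix_vector_mul_lid)
    then have "norm (transpose W *v z) = norm z" for z by (simp add: norm_eq)
    then show "dist (transpose W *v x) (transpose W *v y) = dist x y"
      by (simp only: dist_norm matrix_vector_mult_diff_distrib[symmetric])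
  qed
  also have "\<dots> = emeasure lebesgue (zonotope_list (map ((*v) W) as))"
    using hausdorff_measure_eq_lebesgue[of "zonotope_list (map ((*v) W) as)"]
      convex_compact_zonotope_list[of "map ((*v) W) as"] by simp
  finally show ?thesis by (simp add: emeasure_zonotope_list)
qed

text \<open>All measures involved are finite, so the comparison in \<open>ennreal\<close> is one of
  real numbers. The row types carry the dimensions of the complements.\<close>

lemma projection_inequality_zonotope_list_iff:
  fixes U :: "real^'n^'m" and V :: "real^'n^'m" and UV :: "real^'n^'l"
  assumes "orthonormal_rows U ({u}\<^sup>\<bottom>)" "orthonormal_rows V ({v}\<^sup>\<bottom>)" "orthonormal_rows UV ({u, v}\<^sup>\<bottom>)"
    and "CARD('m) = CARD('n) - 1" "CARD('l) = CARD('n) - 2"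
  shows "projection_inequality (zonotope_list as) u v \<longleftrightarrow>
    measure lebesgue (zonotope_list as) * measure lebesgue (zonotope_list (map ((*v) UV) as))
    \<le> measure lebesgue (zonotope_list (map ((*v) U) as)) * measure lebesgue (zonotope_list (map ((*v) V) as))"
proof -
  note hausdorff = hausdorff_measure_orth_proj_zonotope_list[OF _ subspace_orthogonal_comp]
  show ?thesis
    unfolding projection_inequality_def assms(4,5)[symmetric] emeasure_zonotope_list
      hausdorff[OF assms(1)] hausdorff[OF assms(2)] hausdorff[OF assms(3)]
    by (simp add: ennreal_mult[symmetric])
qed

section \<open>Network matrices\<close>

text \<open>Rows and columns share the index set \<open>I\<close>, so that minors of all sizes live
  in one type and an induction can shrink \<open>I\<close>.\<close>

definition det_on :: "'n set \<Rightarrow> ('n \<Rightarrow> 'n \<Rightarrow> 'a::comm_ring_1) \<Rightarrow> 'a" where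
  "det_on I f = (\<Sum>p | p permutes I. of_int (sign p) * (\<Prod>i\<in>I. f i (p i)))"

lemma minor_eq_det_on: "minor I \<sigma> A = det_on I (\<lambda>i j. A $ i $ \<sigma> j)"
  by (simp add: minor_def det_on_def)

lemma det_on_UNIV: "det_on UNIV f = det (\<chi> i j. f i j)"
  by (simp add: det_on_def det_def)

lemma det_on_permute_columns:
  assumes "finite I" "q permutes I"
  shows "det_on I (\<lambda>i j. f i (q j)) = of_int (sign q) * det_on I f"
proof -
  have "det_on I f = (\<Sum>p | p permutes I. of_int (sign (q \<circ> p)) * (\<Prod>i\<in>I. f i ((q \<circ> p) i)))"
    unfolding det_on_def by (rule setum_permutations_compose_left[OF assms(2)])
  also have "\<dots> = (\<Sum>p | p permutes I. of_int (sign q) * (of_int (sign p) * (\<Prod>i\<in>I. f i (q (p i)))))"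
    using assms by (intro sum.cong) (auto simp: sign_compose permutes_imp_permutation mult.assoc)
  finally have "det_on I f = of_int (sign q) * det_on I (\<lambda>i j. f i (q j))"
    by (simp add: det_on_def sum_distrib_left)
  then have "of_int (sign q) * det_on I f = of_int (sign q * sign q) * det_on I (\<lambda>i j. f i (q j))"
    by (simp only: of_int_mult mult.assoc)
  then show ?thesis by (simp add: sign_idempotent del: of_int_mult)
qed

text \<open>A permutation that moves \<open>k\<close> picks a zero entry of column \<open>k\<close>,
  in the row that it sends to \<open>k\<close>.\<close>

lemma det_on_expand_column:
  assumes I: "finite I" "k \<in> I" and 0: "\<And>i. i \<in> I \<Longrightarrow> i \<noteq> k \<Longrightarrow> f i k = 0"
  shows "det_on I f = f k k * det_on (I - {k}) f"
proof -
  have "det_on I f = (\<Sum>p | p permutes (I - {k}). of_int (sign p) * (\<Prod>i\<in>I. f i (p i)))"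
    unfolding det_on_def
  proof (intro sum.mono_neutral_right ballI)
    show "finite {p. p permutes I}" using I by (simp add: finite_permutations)
    show "{p. p permutes (I - {k})} \<subseteq> {p. p permutes I}"
      using permutes_subset by blast
    fix p assume p: "p \<in> {p. p permutes I} - {p. p permutes (I - {k})}"
    then have pI: "p permutes I" by simp
    have "p k \<noteq> k"
    proof
      assume "p k = k"
      then have "p permutes (I - {k})"
        using pI by (intro permutes_superset[OF pI]) auto
      then show False using p by simp
    qed
    have i: "inv p k \<in> I" "p (inv p k) = k"
      using I permutes_in_image[OF permutes_inv[OF pI]] permutes_inverses(1)[OF pI] by auto
    then have "inv p k \<noteq> k" using \<open>p k \<noteq> k\<close> by auto
    then have "(\<Prod>i\<in>I. f i (p i)) = 0"
      using I i 0 by (intro prod_zero bexI[of _ "inv p k"]) auto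
    then show "of_int (sign p) * (\<Prod>i\<in>I. f i (p i)) = 0" by simp
  qed
  also have "\<dots> = (\<Sum>p | p permutes (I - {k}). f k k * (of_int (sign p) * (\<Prod>i\<in>I - {k}. f i (p i))))"
  proof (intro sum.cong refl)
    fix p assume "p \<in> {p. p permutes (I - {k})}"
    then have "p k = k" by (simp add: permutes_not_in)
    then have "(\<Prod>i\<in>I. f i (p i)) = f k k * (\<Prod>i\<in>I - {k}. f i (p i))"
      using I by (simp add: prod.remove)
    then show "of_int (sign p) * (\<Prod>i\<in>I. f i (p i)) = f k k * (of_int (sign p) * (\<Prod>i\<in>I - {k}. f i (p i)))"
      by (simp add: ac_simps)
  qed
  finally show ?thesis by (simp add: det_on_def sum_distrib_left)
qed

text \<open>The padding consists of unit columns, which are expanded away one index at a time. This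
  makes the rank criterion for singular matrices available to minors.\<close>

lemma det_on_eq_det:
  fixes f :: "'n::finite \<Rightarrow> 'n \<Rightarrow> 'a::comm_ring_1"
  shows "det_on I f = det (\<chi> i j. if j \<in> I then (if i \<in> I then f i j else 0) else (if i = j then 1 else 0))"
proof -
  let ?g = "\<lambda>i j. if j \<in> I then (if i \<in> I then f i j else 0) else (if i = j then 1 else 0)"
  have "det_on (I \<union> K) ?g = det_on I f" if "finite K" "K \<inter> I = {}" for K
    using that
  proof (induction K rule: finite_induct)
    case empty
    have "det_on I ?g = det_on I f"
      unfolding det_on_def by (intro sum.cong arg_cong2[of _ _ _ _ "(*)"] prod.cong) (auto simp: permutes_in_image)
    then show ?case by simp
  next
    case (insert k K)
    have "det_on (I \<union> insert k K) ?g = ?g k k * det_on ((I \<union> insert k K) - {k}) ?g"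
      by (rule det_on_expand_column) (use insert in auto)
    also have "(I \<union> insert k K) - {k} = I \<union> K" using insert by auto
    finally show ?case using insert by simp
  qed
  from this[of "- I"] show ?thesis by (simp add: det_on_UNIV)
qed

text \<open>The indicator vector of \<open>I\<close> is in the kernel of the transpose of the padded
  matrix.\<close>

lemma det_on_column_sums_zero:
  fixes f :: "'n::finite \<Rightarrow> 'n \<Rightarrow> real"
  assumes "I \<noteq> {}" and sum: "\<And>j. j \<in> I \<Longrightarrow> (\<Sum>i\<in>I. f i j) = 0"
  shows "det_on I f = 0"
proof -
  let ?M = "(\<chi> i j. if j \<in> I then (if i \<in> I then f i j else 0) else (if i = j then 1 else 0)) :: real^'n^'n"
  let ?x = "(\<chi> i. if i \<in> I then 1 else 0) :: real^'n"
  have "?x \<noteq> 0" using assms(1) by (auto simp: vec_eq_iff)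
  moreover have "transpose ?M *v ?x = 0"
  proof -
    have "(\<Sum>i\<in>UNIV. (if j \<in> I then (if i \<in> I then f i j else 0) else (if i = j then 1 else 0)) * (if i \<in> I then 1 else 0)) = 0" for j
    proof (cases "j \<in> I")
      case True
      then have "(\<Sum>i\<in>UNIV. (if j \<in> I then (if i \<in> I then f i j else 0) else (if i = j then 1 else 0)) * (if i \<in> I then 1 else 0))
          = (\<Sum>i\<in>UNIV. if i \<in> I then f i j else 0)"
        by (intro sum.cong) auto
      also have "\<dots> = 0" using sum[OF True] by (simp add: sum.inter_filter[symmetric])
      finally show ?thesis .
    next
      case False
      then show ?thesis by (intro sum.neutral) auto
    qed
    then show ?thesis by (simp add: vec_eq_iff matrix_vector_mult_def transpose_def)
  qed
  ultimately have "det (transpose ?M) = 0"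
    using matrix_nonfull_linear_equations_eq[of "transpose ?M"] rank_bound[of "transpose ?M"]
    unfolding det_eq_0_rank by fastforce
  then show ?thesis by (simp add: det_on_eq_det det_transpose)
qed

text \<open>A column with two opposite nonzero entries is an edge of a directed graph, one with a single
  nonzero entry an edge to the deleted vertex. If every column has two nonzero entries, the rows
  add up to zero.\<close>

lemma det_on_network:
  fixes f :: "'n::finite \<Rightarrow> 'n \<Rightarrow> real"
  assumes "\<And>i j. i \<in> I \<Longrightarrow> j \<in> I \<Longrightarrow> f i j \<in> {-1, 0, 1}"
    and "\<And>i i' j. i \<in> I \<Longrightarrow> i' \<in> I \<Longrightarrow> j \<in> I \<Longrightarrow> i \<noteq> i' \<Longrightarrow> f i j \<noteq> 0 \<Longrightarrow> f i' j \<noteq> 0 \<Longrightarrow> f i j + f i' j = 0"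
  shows "\<bar>det_on I f\<bar> \<in> {0, 1}"
  using assms
proof (induction "card I" arbitrary: I f)
  case 0
  then show ?case by (simp add: det_on_def)
next
  case (Suc n)
  have fin: "finite I" by simp
  have ne: "I \<noteq> {}" using Suc.hyps(2) by auto
  show ?case
  proof (cases "\<exists>j\<in>I. \<exists>k\<in>I. \<forall>i\<in>I. i \<noteq> k \<longrightarrow> f i j = 0")
    case True
    then obtain j k where jk: "j \<in> I" "k \<in> I" "\<And>i. i \<in> I \<Longrightarrow> i \<noteq> k \<Longrightarrow> f i j = 0" by blast
    \<comment> \<open>The transposition moves column \<open>j\<close> to position \<open>k\<close>,
      since the expansion expects the possibly nonzero entry on the diagonal.\<close>
    let ?t = "Transposition.transpose k j" and ?J = "I - {k}"
    have t: "?t permutes I" using jk by (intro permutes_swap_id)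
    have tI: "?t i \<in> I" if "i \<in> I" for i using permutes_in_image[OF t] that by simp
    have "\<bar>det_on I f\<bar> = \<bar>det_on I (\<lambda>i j. f i (?t j))\<bar>"
      by (simp add: det_on_permute_columns[OF fin t] abs_mult sign_def)
    also have "\<dots> = \<bar>f k j\<bar> * \<bar>det_on ?J (\<lambda>i j. f i (?t j))\<bar>"
      using det_on_expand_column[OF fin jk(2), of "\<lambda>i j. f i (?t j)"] jk by (simp add: abs_mult)
    finally have eq: "\<bar>det_on I f\<bar> = \<bar>f k j\<bar> * \<bar>det_on ?J (\<lambda>i j. f i (?t j))\<bar>" .
    have "\<bar>det_on ?J (\<lambda>i j. f i (?t j))\<bar> \<in> {0, 1}"
    proof (rule Suc.hyps(1))
      show "n = card ?J" using Suc.hyps(2) jk(2) by simp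
      show "f i (?t j) \<in> {-1, 0, 1}" if "i \<in> ?J" "j \<in> ?J" for i j
        using that tI by (intro Suc.prems(1)) auto
      show "f i (?t j) + f i' (?t j) = 0"
        if "i \<in> ?J" "i' \<in> ?J" "j \<in> ?J" "i \<noteq> i'" "f i (?t j) \<noteq> 0" "f i' (?t j) \<noteq> 0" for i i' j
        using that tI by (intro Suc.prems(2)) auto
    qed
    moreover have "\<bar>f k j\<bar> \<in> {0, 1}" using Suc.prems(1)[OF jk(2,1)] by auto
    ultimately show ?thesis unfolding eq by auto
  next
    case False
    have "(\<Sum>i\<in>I. f i j) = 0" if j: "j \<in> I" for j
    proof -
      obtain k where k: "k \<in> I" "f k j \<noteq> 0" using False ne j by blast
      obtain l where l: "l \<in> I" "l \<noteq> k" "f l j \<noteq> 0" using False k j by blast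
      \<comment> \<open>A third nonzero entry would sum to zero with each of the other two, which
        also sum to zero; then all three would vanish.\<close>
      have other: "f i j = 0" if "i \<in> I - {k, l}" for i
        using Suc.prems(2)[of i k j] Suc.prems(2)[of i l j] Suc.prems(2)[of k l j] that k l j by fastforce
      have "(\<Sum>i\<in>I. f i j) = (\<Sum>i\<in>{k, l}. f i j)"
        using k l other by (intro sum.mono_neutral_right) auto
      also have "\<dots> = 0" using Suc.prems(2)[of k l j] k l j by simp
      finally show ?thesis .
    qed
    then have "det_on I f = 0" using ne by (rule det_on_column_sums_zero[rotated])
    then show ?thesis by simp
  qed
qed

lemma totally_unimodular_network:
  fixes A :: "real^'k^'n"
  assumes "\<And>i j. A $ i $ j \<in> {-1, 0, 1}"
    and "\<And>i i' j. i \<noteq> i' \<Longrightarrow> A $ i $ j \<noteq> 0 \<Longrightarrow> A $ i' $ j \<noteq> 0 \<Longrightarrow> A $ i $ j + A $ i' $ j = 0"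
  shows "totally_unimodular A"
  unfolding totally_unimodular_def
proof (intro allI impI)
  fix I and \<sigma> :: "'n \<Rightarrow> 'k"
  have "\<bar>det_on I (\<lambda>i j. A $ i $ \<sigma> j)\<bar> \<in> {0, 1}"
    by (rule det_on_network) (rule assms, (rule assms; assumption)+)
  then show "minor I \<sigma> A \<in> {-1, 0, 1}" by (auto simp: minor_eq_det_on)
qed

lemma graphical_imp_totally_unimodular:
  fixes A :: "real^'k^'n"
  assumes "graphical A"
  shows "totally_unimodular A"
proof -
  obtain tail head :: "'k \<Rightarrow> 'n option" where
    A: "A = (\<chi> i. incidence_matrix tail head $ Some i)" and "\<And>e. tail e \<noteq> head e"
    using assms by (auto simp: graphical_def oriented_graph_def)
  have "A $ i $ j = (if Some i = head j then 1 else if Some i = tail j then -1 else 0)" for i j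
    by (simp add: A incidence_matrix_def)
  then show ?thesis
    by (intro totally_unimodular_network) (simp, simp split: if_splits, (metis option.inject)+)
qed

text \<open>Multiplication from the left multiplies every maximal minor by \<open>det M\<close>, so
  a unimodular change of basis preserves their absolute values.\<close>

lemma abs_minor_matrix_mult:
  fixes M :: "real^'n^'n" and B :: "real^'k^'n"
  assumes "\<bar>det M\<bar> = 1"
  shows "\<bar>minor UNIV \<sigma> (M ** B)\<bar> = \<bar>minor UNIV \<sigma> B\<bar>"
proof -
  have "(\<chi> i j. (M ** B) $ i $ \<sigma> j) = M ** (\<chi> i j. B $ i $ \<sigma> j)"
    by (simp add: vec_eq_iff matrix_matrix_mult_def)
  then show ?thesis
    using assms by (simp add: minor_eq_det_on det_on_UNIV det_mul abs_mult)
qed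

section \<open>The counterexamples\<close>

lemma vector_6:
  "(vector [a, b, c, d, e, f] :: 'a::zero^6) $ 1 = a" "(vector [a, b, c, d, e, f] :: 'a::zero^6) $ 2 = b"
  "(vector [a, b, c, d, e, f] :: 'a::zero^6) $ 3 = c" "(vector [a, b, c, d, e, f] :: 'a::zero^6) $ 4 = d"
  "(vector [a, b, c, d, e, f] :: 'a::zero^6) $ 5 = e" "(vector [a, b, c, d, e, f] :: 'a::zero^6) $ 6 = f"
  unfolding vector_def by simp_all

lemma vector_7:
  "(vector [a, b, c, d, e, f, g] :: 'a::zero^7) $ 1 = a" "(vector [a, b, c, d, e, f, g] :: 'a::zero^7) $ 2 = b"
  "(vector [a, b, c, d, e, f, g] :: 'a::zero^7) $ 3 = c" "(vector [a, b, c, d, e, f, g] :: 'a::zero^7) $ 4 = d"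
  "(vector [a, b, c, d, e, f, g] :: 'a::zero^7) $ 5 = e" "(vector [a, b, c, d, e, f, g] :: 'a::zero^7) $ 6 = f"
  "(vector [a, b, c, d, e, f, g] :: 'a::zero^7) $ 7 = g"
  unfolding vector_def by simp_all

lemma forall_5: "(\<forall>i::5. P i) \<longleftrightarrow> P 1 \<and> P 2 \<and> P 3 \<and> P 4 \<and> P 5"
proof -
  have "(\<forall>i::5. P i) \<longleftrightarrow> (\<forall>i\<in>{1, 2, 3, 4, 5}. P i)" unfolding UNIV_5[symmetric] by simp
  then show ?thesis by simp
qed

lemma forall_7: "(\<forall>i::7. P i) \<longleftrightarrow> P 1 \<and> P 2 \<and> P 3 \<and> P 4 \<and> P 5 \<and> P 6 \<and> P 7"
proof -
  have "(\<forall>i::7. P i) \<longleftrightarrow> (\<forall>i\<in>{1, 2, 3, 4, 5, 6, 7}. P i)" unfolding UNIV_7[symmetric] by simp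
  then show ?thesis by simp
qed

lemma sum_5: "sum f (UNIV :: 5 set) = f 1 + f 2 + f 3 + f 4 + f 5"
  unfolding UNIV_5 by (simp add: add.assoc)

text \<open>The edges of \<open>K\<^sub>2\<^sub>,\<^sub>3\<close> with one edge of weight 2, in a basis of the lattice that contains
  \<open>u\<close> and \<open>v\<close>. For the matrix with a doubled edge below, \<open>M\<close> is the change of basis.\<close>

definition K23_gens :: "(real^4) list" where
  "K23_gens = [vector [1,1,1,0], vector [0,1,0,0], vector [0,0,2,0],
     vector [-1,-1,-1,1], vector [0,-1,0,1], vector [0,0,-1,1]]"

lemmas zonotope_volume_simps = measure_zonotope_list_det det_2 det_3 det_4 det_5 vector_2 vector_3 vector_4 vector_5
  inner_vec_def sum_2 sum_3 sum_4 sum_5 matrix_vector_mul_component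

text \<open>The matrices drop the fourth coordinate, the first, and both, which projects along
  \<open>u\<close>, along \<open>v\<close>, and along both. The value 20 is the weighted number of
  spanning trees, and 12 = 2 * 2 * 3 the one after contraction of \<open>u\<close>, when the paths
  become three cycles of weights 1 + 1, 1 + 1 and 2 + 1.\<close>

lemma measure_K23_gens:
  "measure lebesgue (zonotope_list K23_gens) = 20"
  "measure lebesgue (zonotope_list (map ((*v) (vector [vector [1,0,0,0], vector [0,1,0,0], vector [0,0,1,0]] :: real^4^3)) K23_gens)) = 12"
  "measure lebesgue (zonotope_list (map ((*v) (vector [vector [0,1,0,0], vector [0,0,1,0], vector [0,0,0,1]] :: real^4^3)) K23_gens)) = 26"
  "measure lebesgue (zonotope_list (map ((*v) (vector [vector [0,1,0,0], vector [0,0,1,0]] :: real^4^2)) K23_gens)) = 16"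
  unfolding K23_gens_def list.map
  \<comment> \<open>The summands must stay folded as \<open>zonotope_list\<close> for the
    determinant formulas to apply.\<close>
  by (subst measure_zonotope_list, simp add: eval_nat_numeral zonotope_volume_simps del: zonotope_list_simps)+

text \<open>The branch vertices are the deleted vertex and vertex 4. The paths between them run
  through 1, through 2, and through 3 and 5.\<close>

definition theta_gens :: "(real^5) list" where
  "theta_gens = [vector [1,0,0,0,0], vector [0,1,0,0,0], vector [0,0,1,0,0],
     vector [-1,0,0,1,0], vector [0,-1,0,1,0], vector [0,0,-1,0,1], vector [0,0,0,-1,1]]"

text \<open>The value 16 = 2 * 2 + 2 * 3 + 2 * 3 counts spanning trees, which omit one edge from
  each of two paths. Contraction of \<open>u\<close>, the fourth unit vector, leaves cycles of
  lengths 2, 2 and 3 with a common vertex, hence 12 trees.\<close>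

lemma measure_theta_gens:
  "measure lebesgue (zonotope_list theta_gens) = 16"
  "measure lebesgue (zonotope_list (map ((*v) (vector [vector [1,0,0,0,0], vector [0,1,0,0,0],
     vector [0,0,1,0,0], vector [0,0,0,0,1]] :: real^5^4)) theta_gens)) = 12"
  "measure lebesgue (zonotope_list (map ((*v) (vector [vector [0,0,0,1,0], vector [1/2,-1/2,1/2,0,-1/2],
     vector [1/2,1/2,1/2,0,1/2], vector [1/2,-1/2,-1/2,0,1/2]] :: real^5^4)) theta_gens)) = 18"
  "measure lebesgue (zonotope_list (map ((*v) (vector [vector [1/2,-1/2,1/2,0,-1/2],
     vector [1/2,1/2,1/2,0,1/2], vector [1/2,-1/2,-1/2,0,1/2]] :: real^5^3)) theta_gens)) = 14"
  unfolding theta_gens_def list.map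
  by (subst measure_zonotope_list, simp add: eval_nat_numeral zonotope_volume_simps del: zonotope_list_simps)+

lemma sum_7: "sum f (UNIV :: 7 set) = f 1 + f 2 + f 3 + f 4 + f 5 + f 6 + f 7"
  unfolding UNIV_7 by (simp add: add.assoc)

section \<open>Orthonormal bases of the complements\<close>

lemma orthogonal_comp_insert_iff: "z \<in> (insert u S)\<^sup>\<bottom> \<longleftrightarrow> u \<bullet> z = 0 \<and> z \<in> S\<^sup>\<bottom>"
  "z \<in> {}\<^sup>\<bottom>"
  by (auto simp: orthogonal_comp_def orthogonal_def)

lemma orthonormal_rows_4:
  "orthonormal_rows (vector [vector [1,0,0,0], vector [0,1,0,0], vector [0,0,1,0]] :: real^4^3)
     ({vector [0,0,0,1]}\<^sup>\<bottom>)"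
  "orthonormal_rows (vector [vector [0,1,0,0], vector [0,0,1,0], vector [0,0,0,1]] :: real^4^3)
     ({vector [1,0,0,0]}\<^sup>\<bottom>)"
  "orthonormal_rows (vector [vector [0,1,0,0], vector [0,0,1,0]] :: real^4^2)
     ({vector [0,0,0,1], vector [1,0,0,0]}\<^sup>\<bottom>)"
  by (simp_all add: orthonormal_rows_def orthogonal_comp_insert_iff vec_eq_iff forall_2 forall_3 forall_4
      matrix_matrix_mult_def mat_def transpose_def matrix_vector_mult_def inner_vec_def sum_2 sum_3 sum_4
      vector_2 vector_3 vector_4 vector_matrix_mult_def)

text \<open>In the coordinates 1, 2, 3 and 5, the vector \<open>v\<close> and the three rows with
  entries \<open>1/2\<close> and \<open>-1/2\<close> are the rows of half a Hadamard matrix of order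
  4, which gives a rational orthonormal basis.\<close>

lemma orthonormal_rows_5:
  "orthonormal_rows (vector [vector [1,0,0,0,0], vector [0,1,0,0,0],
     vector [0,0,1,0,0], vector [0,0,0,0,1]] :: real^5^4) ({vector [0,0,0,1,0]}\<^sup>\<bottom>)"
  "orthonormal_rows (vector [vector [0,0,0,1,0], vector [1/2,-1/2,1/2,0,-1/2],
     vector [1/2,1/2,1/2,0,1/2], vector [1/2,-1/2,-1/2,0,1/2]] :: real^5^4) ({vector [1/2,1/2,-1/2,0,-1/2]}\<^sup>\<bottom>)"
  "orthonormal_rows (vector [vector [1/2,-1/2,1/2,0,-1/2],
     vector [1/2,1/2,1/2,0,1/2], vector [1/2,-1/2,-1/2,0,1/2]] :: real^5^3)
     ({vector [0,0,0,1,0], vector [1/2,1/2,-1/2,0,-1/2]}\<^sup>\<bottom>)"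
  by (auto simp add: orthonormal_rows_def orthogonal_comp_insert_iff vec_eq_iff forall_3 forall_4 forall_5
      matrix_matrix_mult_def mat_def transpose_def matrix_vector_mult_def inner_vec_def sum_3 sum_4 sum_5
      vector_3 vector_4 vector_5 vector_matrix_mult_def field_simps)

section \<open>Failure of the inequality\<close>

lemma not_projection_inequality_K23:
  "\<not> projection_inequality (zonotope_list K23_gens) (vector [0,0,0,1]) (vector [1,0,0,0])"
  by (subst projection_inequality_zonotope_list_iff[OF orthonormal_rows_4]) (simp_all only: measure_K23_gens, simp_all)

text \<open>\<open>v\<close> has the entry \<open>1/2\<close> at the inner vertices of the two short
  paths, \<open>-1/2\<close> at those of the long path, and 0 at the branch vertex 4.\<close>

lemma not_projection_inequality_theta:
  "\<not> projection_inequality (zonotope_list theta_gens) (vector [0,0,0,1,0]) (vector [1/2,1/2,-1/2,0,-1/2])"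
  by (subst projection_inequality_zonotope_list_iff[OF orthonormal_rows_5]) (simp_all only: measure_theta_gens, simp_all)

lemma zonotope_vector_6: "zonotope (\<lambda>j. (vector [a, b, c, d, e, f] :: 'a::euclidean_space^6) $ j) = zonotope_list [a, b, c, d, e, f]"
proof -
  have "distinct [1, 2, 3, 4, 5, 6 :: 6]" by simp
  moreover have "set [1, 2, 3, 4, 5, 6 :: 6] = UNIV" by (simp only: UNIV_6 list.set)
  ultimately show ?thesis by (simp only: zonotope_eq_zonotope_list list.map vector_6)
qed

lemma zonotope_columns_vector_7:
  "zonotope (\<lambda>j. column j (transpose (vector [a, b, c, d, e, f, g] :: real^'n^7))) = zonotope_list [a, b, c, d, e, f, g]"
proof -
  have "distinct [1, 2, 3, 4, 5, 6, 7 :: 7]" by simp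
  moreover have "set [1, 2, 3, 4, 5, 6, 7 :: 7] = UNIV" by (simp only: UNIV_7 list.set)
  ultimately show ?thesis
    by (simp only: zonotope_eq_zonotope_list list.map column_transpose row_def vec_nth_inverse vec_lambda_eta vector_7)
qed

section \<open>The unimodular matrix\<close>

text \<open>Allows a generator of weight 2 to be replaced by two equal columns.\<close>

lemma closed_segment_double: "closed_segment 0 a + closed_segment 0 a = closed_segment 0 (2 *\<^sub>R a)"
  for a :: "'a::real_vector"
proof (intro set_eqI iffI)
  fix y assume "y \<in> closed_segment 0 a + closed_segment 0 a"
  then obtain q r where "0 \<le> q" "q \<le> 1" "0 \<le> r" "r \<le> 1" "y = q *\<^sub>R a + r *\<^sub>R a"
    by (elim set_plus_elim) (auto simp: in_segment)
  then show "y \<in> closed_segment 0 (2 *\<^sub>R a)"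
    unfolding in_segment by (intro exI[of _ "(q + r) / 2"]) (auto simp: scaleR_left_distrib[symmetric])
next
  fix y assume "y \<in> closed_segment 0 (2 *\<^sub>R a)"
  then obtain u where u: "0 \<le> u" "u \<le> 1" "y = u *\<^sub>R a + u *\<^sub>R a"
    by (auto simp: in_segment scaleR_2 scaleR_add_right mult_2_right scaleR_left_distrib)
  then have "u *\<^sub>R a \<in> closed_segment 0 a" by (auto simp: in_segment)
  then show "y \<in> closed_segment 0 a + closed_segment 0 a" unfolding u(3) by (intro set_plus_intro)
qed

definition K23_matrix :: "real^7^4" where
  "K23_matrix = transpose (vector [vector [1,1,1,0], vector [0,1,0,0], vector [0,0,1,0], vector [0,0,1,0],
     vector [-1,-1,-1,1], vector [0,-1,0,1], vector [0,0,-1,1]])"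

lemma zonotope_K23_matrix: "zonotope (\<lambda>j. column j K23_matrix) = zonotope_list K23_gens"
proof -
  have "(vector [0,0,2,0] :: real^4) = 2 *\<^sub>R vector [0,0,1,0]"
    by (simp add: vec_eq_iff forall_4 vector_4)
  then show ?thesis
    unfolding K23_matrix_def zonotope_columns_vector_7 K23_gens_def
    by (simp add: closed_segment_double[symmetric] add.assoc)
qed

text \<open>\<open>B\<close> is the reduced incidence matrix of \<open>K_{2,3}\<close> with a
  doubled edge. Its parallel edges exclude \<open>graphical\<close>, so its total unimodularity
  comes from the network criterion. The integral matrix \<open>M\<close> of determinant 1 then
  carries the result over to the maximal minors of \<open>K23_matrix\<close>.\<close>

lemma unimodular_K23_matrix: "unimodular K23_matrix"
proof -
  define M :: "real^4^4" where
    "M = transpose (vector [vector [1,1,1,0], vector [0,1,0,0], vector [0,0,1,0], vector [0,0,0,1]])"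
  define B :: "real^7^4" where
    "B = transpose (vector [vector [1,0,0,0], vector [0,1,0,0], vector [0,0,1,0], vector [0,0,1,0],
       vector [-1,0,0,1], vector [0,-1,0,1], vector [0,0,-1,1]])"
  have eq: "K23_matrix = M ** B"
    by (simp add: K23_matrix_def M_def B_def vec_eq_iff forall_4 forall_7 transpose_def matrix_matrix_mult_def
        sum_4 vector_4 vector_7)
  have det: "det M = 1"
    unfolding M_def det_transpose by (simp add: det_4 vector_4)
  have entries: "\<forall>i j. B $ i $ j \<in> {-1, 0, 1}"
    by (simp add: B_def forall_4 forall_7 transpose_def vector_4 vector_7)
  have opposite: "\<forall>i i' j. i \<noteq> i' \<longrightarrow> B $ i $ j \<noteq> 0 \<longrightarrow> B $ i' $ j \<noteq> 0 \<longrightarrow> B $ i $ j + B $ i' $ j = 0"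
    by (simp add: B_def forall_4 forall_7 transpose_def vector_4 vector_7)
  have B: "totally_unimodular B"
    using entries opposite by (intro totally_unimodular_network) blast+
  have "\<bar>minor UNIV \<sigma> K23_matrix\<bar> = 1" if "inj \<sigma>" "minor UNIV \<sigma> K23_matrix \<noteq> 0" for \<sigma>
  proof -
    have "minor UNIV \<sigma> B \<in> {-1, 0, 1}"
      using B that(1) by (simp add: totally_unimodular_def)
    moreover have "\<bar>minor UNIV \<sigma> K23_matrix\<bar> = \<bar>minor UNIV \<sigma> B\<bar>"
      unfolding eq by (rule abs_minor_matrix_mult) (simp add: det)
    ultimately show ?thesis using that(2) by auto
  qed
  moreover have "integer_matrix K23_matrix"
    by (simp add: integer_matrix_def K23_matrix_def forall_4 forall_7 transpose_def vector_4 vector_7)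
  moreover have "rank K23_matrix = CARD(4)"
    unfolding full_rank_surjective surj_def
  proof
    fix y :: "real^4"
    \<comment> \<open>Columns 1, 2, 3 and 6 form a basis; only column 6 among them has a nonzero
      fourth entry, which fixes its coefficient.\<close>
    have "y = K23_matrix *v vector [y$1, y$2 - y$1 + y$4, y$3 - y$1, 0, 0, y$4, 0]"
      by (simp add: vec_eq_iff forall_4 K23_matrix_def transpose_def matrix_vector_mult_def sum_7 vector_4 vector_7)
    then show "\<exists>x. y = K23_matrix *v x" ..
  qed
  ultimately show ?thesis by (simp add: unimodular_def)
qed

section \<open>The graphical matrix\<close>

definition theta_matrix :: "real^7^5" where
  "theta_matrix = transpose (vector [vector [1,0,0,0,0], vector [0,1,0,0,0], vector [0,0,1,0,0],
     vector [-1,0,0,1,0], vector [0,-1,0,1,0], vector [0,0,-1,0,1], vector [0,0,0,-1,1]])"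

lemma graphical_theta_matrix: "graphical theta_matrix"
  unfolding graphical_def
proof (intro exI conjI)
  \<comment> \<open>Edges 1, 2 and 3 leave the deleted vertex \<open>None\<close>, the default tail;
    edges 6 and 7 enter \<open>Some 5\<close>, the default head.\<close>
  let ?tail = "(\<lambda>_. None)(4 := Some 1, 5 := Some 2, 6 := Some 3, 7 := Some 4) :: 7 \<Rightarrow> 5 option"
  let ?head = "(\<lambda>_. Some 5)(1 := Some 1, 2 := Some 2, 3 := Some 3, 4 := Some 4, 5 := Some 4) :: 7 \<Rightarrow> 5 option"
  show "oriented_graph ?tail ?head"
    unfolding oriented_graph_def inj_def forall_7 by (simp add: doubleton_eq_iff)
  show "connected_graph ?tail ?head"
    unfolding connected_graph_def
  proof (intro allI)
    let ?R = "{(x, y). \<exists>e. {x, y} = {?tail e, ?head e}}"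
    have "sym ?R" by (auto simp: sym_def insert_commute)
    then have sym: "(y, x) \<in> ?R\<^sup>*" if "(x, y) \<in> ?R\<^sup>*" for x y
      using that by (rule symD[OF sym_rtrancl])
    have edge: "(?tail e, ?head e) \<in> ?R" for e
      by (intro CollectI case_prodI exI[of _ e] refl)
    have 1: "(None, Some 1) \<in> ?R" and 2: "(None, Some 2) \<in> ?R" and 3: "(None, Some 3) \<in> ?R"
      and 14: "(Some 1, Some 4) \<in> ?R" and 35: "(Some 3, Some 5) \<in> ?R"
      using edge[of 1] edge[of 2] edge[of 3] edge[of 4] edge[of 6] by simp_all
    \<comment> \<open>Vertices 1, 2 and 3 are neighbours of the root \<open>None\<close>, vertex 4
      is reached through 1, and vertex 5 through 3. By symmetry any two vertices are joined through
      the root.\<close>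
    have "\<forall>i. (None, Some i) \<in> ?R\<^sup>*"
      unfolding forall_5
      by (intro conjI r_into_rtrancl[OF 1] r_into_rtrancl[OF 2] r_into_rtrancl[OF 3]
          rtrancl_trans[OF r_into_rtrancl[OF 1] r_into_rtrancl[OF 14]]
          rtrancl_trans[OF r_into_rtrancl[OF 3] r_into_rtrancl[OF 35]])
    then have root: "(None, x) \<in> ?R\<^sup>*" for x by (cases x) auto
    show "(x, y) \<in> ?R\<^sup>*" for x y
      using rtrancl_trans[OF sym[OF root] root] .
  qed
  show "theta_matrix = (\<chi> i. incidence_matrix ?tail ?head $ Some i)"
    unfolding vec_eq_iff forall_5 forall_7
    by (simp add: theta_matrix_def incidence_matrix_def transpose_def vector_5 vector_7)
qed

theorem theorem3:
  shows "(\<exists>(a :: 6 \<Rightarrow> real^4) u v.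
            orthonormal_pair u v \<and> \<not> projection_inequality (zonotope a) u v)
       \<and> (\<exists>(A :: real^7^4) u v.
            unimodular A \<and> orthonormal_pair u v \<and>
            \<not> projection_inequality (zonotope (\<lambda>j. column j A)) u v)
       \<and> (\<exists>(A :: real^7^5) u v.
            graphical A \<and> totally_unimodular A \<and> orthonormal_pair u v \<and>
            \<not> projection_inequality (zonotope (\<lambda>j. column j A)) u v)"
proof (intro conjI)
  have uv4: "orthonormal_pair (vector [0,0,0,1] :: real^4) (vector [1,0,0,0])"
    by (simp add: orthonormal_pair_def orthogonal_def norm_eq_1 inner_vec_def sum_4 vector_4)
  have uv5: "orthonormal_pair (vector [0,0,0,1,0] :: real^5) (vector [1/2,1/2,-1/2,0,-1/2])"
    by (simp add: orthonormal_pair_def orthogonal_def norm_eq_1 inner_vec_def sum_5 vector_5)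
  show "\<exists>(a :: 6 \<Rightarrow> real^4) u v. orthonormal_pair u v \<and> \<not> projection_inequality (zonotope a) u v"
    using uv4 not_projection_inequality_K23 unfolding K23_gens_def zonotope_vector_6[symmetric] by blast
  show "\<exists>(A :: real^7^4) u v. unimodular A \<and> orthonormal_pair u v \<and>
      \<not> projection_inequality (zonotope (\<lambda>j. column j A)) u v"
    using uv4 not_projection_inequality_K23 unimodular_K23_matrix unfolding zonotope_K23_matrix[symmetric] by blast
  have "zonotope (\<lambda>j. column j theta_matrix) = zonotope_list theta_gens"
    unfolding theta_matrix_def zonotope_columns_vector_7 theta_gens_def ..
  then show "\<exists>(A :: real^7^5) u v. graphical A \<and> totally_unimodular A \<and> orthonormal_pair u v \<and>
      \<not> projection_inequality (zonotope (\<lambda>j. column j A)) u v"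
    using uv5 not_projection_inequality_theta graphical_theta_matrix
      graphical_imp_totally_unimodular[OF graphical_theta_matrix] by metis
qed

end
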